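(* Let $k\in\{-1,0,1\}$ and let $N\ge2$ be an integer. For fixed $r_h>0$ and fixed $\omega_{1,h},\dots,\omega_{N-1,h}\in\mathbb{R}\setminus\{0\}$, and for $|\Lambda|$ sufficiently large (with $\Lambda<0$), there exists a black hole solution of the $\mathfrak{su}(N)$ Einstein--Yang--Mills field equations with cosmological constant $\Lambda$, with event horizon at $r_h$ and $\omega_j(r_h)=\omega_{j,h}$ for $j=1,\dots,N-1$, such that all the gauge field functions $\omega_j(r)$ have no zeroes.
   Context: Fix $k\in\{-1,0,1\}$ and an integer $N\ge2$. The $\mathfrak{su}(N)$ field equations with cosmological constant $\Lambda<0$ are the following ordinary differential equations for real functions $m(r)$, $S(r)>0$, $\omega_1(r),\dots,\omega_{N-1}(r)$ (prime is $d/dr$, and $\omega_0\equiv\omega_N\equiv0$): $$r^2\mu\,\omega_j''+\Big(2m-2r^3p_{\theta,k}-\tfrac{2\Lambda r^3}{3}\Big)\omega_j'+W_{k,j}\,\omega_j=0\quad(j=1,\dots,N-1),$$ $$m'=\mu G+r^2p_{\theta,k},\qquad \frac{S'}{S}=\frac{2G}{r},$$ where $$\mu=k-\frac{2m}{r}-\frac{\Lambda r^2}{3},\qquad G=\sum_{j=1}^{N-1}\omega_j'^2,\qquad W_{k,j}=k-\omega_j^2+\tfrac12(\omega_{j-1}^2+\omega_{j+1}^2),$$ $$p_{\theta,k}=\frac{1}{4r^4}\sum_{j=1}^{N}\big(\omega_j^2-\omega_{j-1}^2-k(N+1-2j)\big)^2 .$$ (They are the equations of static, purely magnetic EYM theory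 with metric $ds^2=-\mu S^2dt^2+\mu^{-1}dr^2+r^2d\theta^2+r^2f_k^2(\theta)d\phi^2$, where $f_1=\sin\theta$, $f_0=\theta$, $f_{-1}=\sinh\theta$.) A black hole solution with event horizon radius $r_h>0$ is a solution regular on $[r_h,\infty)$ such that: (i) $\mu(r_h)=0$, i.e. $2m(r_h)=kr_h-\Lambda r_h^3/3$, with $\mu'(r_h)>0$ (non-extremal horizon), and $m,S,\omega_j$ have regular Taylor expansions about $r_h$; (ii) $\mu(r)>0$ for all $r>r_h$; (iii) as $r\to\infty$, $m(r)=M+O(r^{-1})$, $S(r)=1+O(r^{-1})$, $\omega_j(r)=\omega_{j,\infty}+O(r^{-1})$ for some real constants $M,\omega_{j,\infty}$. "No zeroes" means $\omega_j(r)\neq0$ for all $r\in[r_h,\infty)$. *)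

theory Defs
  imports "HOL-Analysis.Analysis" "HOL-Library.Landau_Symbols"
begin

text \<open>
  The field equations of static, purely magnetic su(N) Einstein--Yang--Mills theory for the metric
  \<open>- \<mu> S\<^sup>2 dt\<^sup>2 + dr\<^sup>2 / \<mu> + r\<^sup>2 d\<theta>\<^sup>2 + r\<^sup>2 f\<^sub>k(\<theta>)\<^sup>2 d\<phi>\<^sup>2\<close>.
  The gauge functions are a family \<open>\<omega> :: nat \<Rightarrow> real \<Rightarrow> real\<close> of which the indices \<open>0..N\<close> are
  relevant, with \<open>\<omega> 0 = \<omega> N = 0\<close>. The arguments \<open>w\<close>, \<open>w'\<close> below stand for the values
  \<open>\<lambda>j. \<omega> j r\<close>, \<open>\<lambda>j. \<omega>' j r\<close> at one radius.
\<close>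

definition metric_mu :: "real \<Rightarrow> real \<Rightarrow> (real \<Rightarrow> real) \<Rightarrow> real \<Rightarrow> real" where
  "metric_mu k \<Lambda> m r = k - 2 * m r / r - \<Lambda> * r^2 / 3"

definition gauge_G :: "nat \<Rightarrow> (nat \<Rightarrow> real) \<Rightarrow> real" where
  "gauge_G N w' = (\<Sum>j\<in>{1..N-1}. (w' j)^2)"

definition gauge_W :: "real \<Rightarrow> (nat \<Rightarrow> real) \<Rightarrow> nat \<Rightarrow> real" where
  "gauge_W k w j = k - (w j)^2 + 1/2 * ((w (j - 1))^2 + (w (j + 1))^2)"

definition p_theta :: "nat \<Rightarrow> real \<Rightarrow> (nat \<Rightarrow> real) \<Rightarrow> real \<Rightarrow> real" where
  "p_theta N k w r =
     1 / (4 * r^4) *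
     (\<Sum>j\<in>{1..N}. ((w j)^2 - (w (j - 1))^2 - k * (real N + 1 - 2 * real j))^2)"

text \<open>
  Derivatives are taken within the interval \<open>I\<close>, hence one-sided at an endpoint belonging to \<open>I\<close>.
\<close>

definition sun_eym_solution_on ::
  "real set \<Rightarrow> nat \<Rightarrow> real \<Rightarrow> real \<Rightarrow> (real \<Rightarrow> real) \<Rightarrow> (real \<Rightarrow> real) \<Rightarrow> (nat \<Rightarrow> real \<Rightarrow> real) \<Rightarrow> bool"
where
  "sun_eym_solution_on I N k \<Lambda> m S \<omega> \<longleftrightarrow>
     (\<forall>r\<in>I. \<omega> 0 r = 0 \<and> \<omega> N r = 0 \<and> S r > 0) \<and>
     (\<exists>m' S' \<omega>' \<omega>''. \<forall>r\<in>I.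
        (m has_real_derivative m' r) (at r within I) \<and>
        (S has_real_derivative S' r) (at r within I) \<and>
        (\<forall>j\<in>{1..N-1}.
           (\<omega> j has_real_derivative \<omega>' j r) (at r within I) \<and>
           (\<omega>' j has_real_derivative \<omega>'' j r) (at r within I) \<and>
           r^2 * metric_mu k \<Lambda> m r * \<omega>'' j r
             + (2 * m r - 2 * r^3 * p_theta N k (\<lambda>i. \<omega> i r) r - 2 * \<Lambda> * r^3 / 3) * \<omega>' j r
             + gauge_W k (\<lambda>i. \<omega> i r) j * \<omega> j r = 0) \<and>
        m' r = metric_mu k \<Lambda> m r * gauge_G N (\<lambda>i. \<omega>' i r)
                 + r^2 * p_theta N k (\<lambda>i. \<omega> i r) r \<and>
        S' r / S r = 2 * gauge_G N (\<lambda>i. \<omega>' i r) / r)"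

text \<open>
  Only values at \<open>r \<ge> r\<^sub>0\<close> are constrained, since the functions matter on the exterior of the
  horizon only; convergence on a right neighbourhood already forces a positive radius of convergence.
\<close>

definition has_regular_taylor_at_right :: "(real \<Rightarrow> real) \<Rightarrow> real \<Rightarrow> bool" where
  "has_regular_taylor_at_right f r\<^sub>0 \<longleftrightarrow>
     (\<exists>\<epsilon>>0. \<exists>a :: nat \<Rightarrow> real. \<forall>r\<in>{r\<^sub>0..<r\<^sub>0 + \<epsilon>}. (\<lambda>n. a n * (r - r\<^sub>0)^n) sums f r)"

definition black_hole_solution ::
  "nat \<Rightarrow> real \<Rightarrow> real \<Rightarrow> real \<Rightarrow> (real \<Rightarrow> real) \<Rightarrow> (real \<Rightarrow> real) \<Rightarrow> (nat \<Rightarrow> real \<Rightarrow> real) \<Rightarrow> bool"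
where
  "black_hole_solution N k \<Lambda> r\<^sub>h m S \<omega> \<longleftrightarrow>
     r\<^sub>h > 0 \<and>
     sun_eym_solution_on {r\<^sub>h..} N k \<Lambda> m S \<omega> \<and>
     metric_mu k \<Lambda> m r\<^sub>h = 0 \<and>
     (\<exists>d>0. (metric_mu k \<Lambda> m has_real_derivative d) (at r\<^sub>h within {r\<^sub>h..})) \<and>
     has_regular_taylor_at_right m r\<^sub>h \<and>
     has_regular_taylor_at_right S r\<^sub>h \<and>
     (\<forall>j\<in>{1..N-1}. has_regular_taylor_at_right (\<omega> j) r\<^sub>h) \<and>
     (\<forall>r>r\<^sub>h. metric_mu k \<Lambda> m r > 0) \<and>
     (\<exists>M. (\<lambda>r. m r - M) \<in> O[at_top](\<lambda>r. 1 / r)) \<and>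
     (\<lambda>r. S r - 1) \<in> O[at_top](\<lambda>r. 1 / r) \<and>
     (\<forall>j\<in>{1..N-1}. \<exists>w_inf. (\<lambda>r. \<omega> j r - w_inf) \<in> O[at_top](\<lambda>r. 1 / r))"

end

theory Submission
  imports Defs "HOL-Complex_Analysis.Cauchy_Integral_Formula"
begin

text \<open>
  The proof solves the whole boundary value problem by one contraction. In \<open>t = 1 - r\<^sub>h/r\<close> the
  exterior becomes \<open>[0, 1)\<close> and infinity the regular point \<open>t = 1\<close>; the equations for \<open>S\<close>,
  \<open>2 m S / r\<^sub>h\<close> and \<open>Y \<omega>\<^sub>j'\<close>, where \<open>Y = S \<mu> (1 - t)\<^sup>2\<close>, can be integrated from the horizon, which
  gives a fixed point equation for \<open>S\<close> and the \<open>\<omega>\<^sub>j'\<close>. With \<open>c = -\<Lambda> r\<^sub>h\<^sup>2 / 3\<close> one has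
  \<open>Y = c (1 - (1 - t)\<^sup>3) + O(1)\<close>, and \<open>1 - (1 - t)\<^sup>3 = t (3 - 3t + t\<^sup>2)\<close> has no zero besides \<open>t = 0\<close> in
  the complex disc of radius \<open>5/4\<close>. Hence for large \<open>c\<close> the map is a contraction on bounded
  holomorphic functions there, of constant \<open>O(1 / sqrt c)\<close>. Analyticity at the horizon, the
  decay at infinity (differentiability at \<open>t = 1\<close>) and the smallness of \<open>\<omega>\<^sub>j - \<omega>\<^sub>j(r\<^sub>h)\<close>, which
  excludes zeroes, all come with the fixed point.
\<close>

section \<open>Contraction principle for families of functions\<close>

text \<open>Picard iteration. The sup distance is represented by its upper bounds \<open>d\<close>,
  which \<open>T\<close> halves; \<open>B\<close> bounds the diameter of \<open>K\<close>, and
  closedness concerns limits that are uniform in index and point together.\<close>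

lemma uniform_contraction_fixpoint:
  fixes T :: "('i \<Rightarrow> 'a \<Rightarrow> 'b::complete_space) \<Rightarrow> 'i \<Rightarrow> 'a \<Rightarrow> 'b"
  assumes start: "u\<^sub>0 \<in> K"
    and maps: "\<And>u. u \<in> K \<Longrightarrow> T u \<in> K"
    and contr: "\<And>u w d i x. \<lbrakk>u \<in> K; w \<in> K; \<And>i x. x \<in> A \<Longrightarrow> dist (u i x) (w i x) \<le> d; x \<in> A\<rbrakk>
                  \<Longrightarrow> dist (T u i x) (T w i x) \<le> d / 2"
    and bdd: "\<And>u w i x. \<lbrakk>u \<in> K; w \<in> K; x \<in> A\<rbrakk> \<Longrightarrow> dist (u i x) (w i x) \<le> B"
    and closed: "\<And>f g. \<lbrakk>\<And>n. f n \<in> K;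
                   uniform_limit (UNIV \<times> A) (\<lambda>n (i, x). f n i x) (\<lambda>(i, x). g i x) sequentially\<rbrakk>
                  \<Longrightarrow> g \<in> K"
  obtains u where "u \<in> K" "\<And>i x. x \<in> A \<Longrightarrow> T u i x = u i x"
proof -
  define f where "f n = (T ^^ n) u\<^sub>0" for n
  have fK: "f n \<in> K" for n
    by (induction n) (auto simp: f_def start maps)
  have f_Suc: "f (Suc n) = T (f n)" for n
    by (simp add: f_def)
  \<comment> \<open>Induction on \<open>n\<close> for a fixed gap \<open>p\<close>: the diameter
    bound starts it, so no geometric series has to be summed.\<close>
  have shift: "dist (f n i x) (f (n + p) i x) \<le> B / 2 ^ n" if "x \<in> A" for n p i x
    using that
  proof (induction n arbitrary: i x)
    case 0
    then show ?case using bdd fK by simp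
  next
    case (Suc n)
    have "dist (T (f n) i x) (T (f (n + p)) i x) \<le> (B / 2 ^ n) / 2"
      by (rule contr) (use fK Suc in auto)
    then show ?case by (simp add: f_Suc)
  qed
  have lim0: "(\<lambda>n. B / 2 ^ n) \<longlonglongrightarrow> 0"
    by real_asymp
  have "uniformly_convergent_on (UNIV \<times> A) (\<lambda>n (i, x). f n i x)"
  proof (intro Cauchy_uniformly_convergent uniformly_Cauchy_onI')
    fix e :: real assume "e > 0"
    with lim0 have "\<forall>\<^sub>F n in sequentially. B / 2 ^ n < e"
      by (rule order_tendstoD)
    then obtain M where M: "\<And>n. n \<ge> M \<Longrightarrow> B / 2 ^ n < e"
      by (auto simp: eventually_sequentially)
    show "\<exists>M. \<forall>x\<in>UNIV \<times> A. \<forall>m\<ge>M. \<forall>n>m.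
            dist (case x of (i, x) \<Rightarrow> f m i x) (case x of (i, x) \<Rightarrow> f n i x) < e"
    proof (intro exI[of _ M] ballI allI impI, clarify)
      fix i x and m n :: nat assume *: "x \<in> A" "M \<le> m" "m < n"
      have "dist (f m i x) (f (m + (n - m)) i x) \<le> B / 2 ^ m"
        by (rule shift) fact
      also have "\<dots> < e" by (rule M) fact
      finally show "dist (f m i x) (f n i x) < e" using * by simp
    qed
  qed
  then obtain h where h: "uniform_limit (UNIV \<times> A) (\<lambda>n (i, x). f n i x) h sequentially"
    by (auto simp: uniformly_convergent_on_def)
  define g where "g i x = h (i, x)" for i x
  have lim: "uniform_limit (UNIV \<times> A) (\<lambda>n (i, x). f n i x) (\<lambda>(i, x). g i x) sequentially"
    using h by (simp add: g_def case_prod_unfold)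
  have gK: "g \<in> K" by (rule closed[OF fK lim])
  have pw: "(\<lambda>n. f n i x) \<longlonglongrightarrow> g i x" if "x \<in> A" for i x
    using tendsto_uniform_limitI[OF lim, of "(i, x)"] that by simp
  have near: "dist (f n i x) (g i x) \<le> B / 2 ^ n" if "x \<in> A" for n i x
  proof (rule tendsto_upperbound)
    have "(\<lambda>p. f (p + n) i x) \<longlonglongrightarrow> g i x"
      using pw[OF that] by (rule LIMSEQ_ignore_initial_segment)
    then show "(\<lambda>p. dist (f n i x) (f (n + p) i x)) \<longlonglongrightarrow> dist (f n i x) (g i x)"
      by (intro tendsto_dist tendsto_const) (simp add: add.commute)
    show "\<forall>\<^sub>F p in sequentially. dist (f n i x) (f (n + p) i x) \<le> B / 2 ^ n"
      using shift[OF that] by simp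
  qed simp
  \<comment> \<open>\<open>T (f n)\<close> tends to \<open>T g\<close> by contraction of the bound
    \<open>near\<close>, and to \<open>g\<close> because it is the shifted sequence
    \<open>f (Suc n)\<close>.\<close>
  have "T g i x = g i x" if "x \<in> A" for i x
  proof (rule LIMSEQ_unique)
    have "(\<lambda>n. dist (T (f n) i x) (T g i x)) \<longlonglongrightarrow> 0"
    proof (rule tendsto_sandwich[OF _ _ tendsto_const])
      show "\<forall>\<^sub>F n in sequentially. dist (T (f n) i x) (T g i x) \<le> (B / 2 ^ n) / 2"
        by (intro always_eventually allI contr fK gK near that)
      show "(\<lambda>n. B / 2 ^ n / 2) \<longlonglongrightarrow> 0" by real_asymp
    qed simp
    then show "(\<lambda>n. T (f n) i x) \<longlonglongrightarrow> T g i x"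
      using tendsto_dist_iff by blast
    show "(\<lambda>n. T (f n) i x) \<longlonglongrightarrow> g i x"
      using pw[OF that] LIMSEQ_Suc unfolding f_Suc[symmetric] by blast
  qed
  with gK show ?thesis by (rule that)
qed

subsection \<open>Holomorphic functions on a disc that are real on the real axis\<close>

text \<open>The radius exceeds 1, so that infinity, at t = 1, is an interior point; it stays below
  sqrt 3, the modulus of both zeros of 3 - 3z + z^2.\<close>

definition dom_ball :: "complex set" where
  "dom_ball = ball 0 (5/4)"

text \<open>Conjugation symmetry is an identity at each point of the disc, so it passes directly to
  sums, products, quotients, integrals and limits; on the real axis it says that the values are
  real.\<close>

definition real_holo :: "(complex \<Rightarrow> complex) \<Rightarrow> bool" where
  "real_holo f \<longleftrightarrow> f holomorphic_on dom_ball \<and> (\<forall>z\<in>dom_ball. f (cnj z) = cnj (f z))"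

lemma open_dom_ball [simp]: "open dom_ball"
  and convex_dom_ball [simp]: "convex dom_ball"
  and cnj_in_dom_ball [simp]: "cnj z \<in> dom_ball \<longleftrightarrow> z \<in> dom_ball"
  by (auto simp: dom_ball_def)

lemma of_real_in_dom_ball [simp]: "of_real t \<in> dom_ball \<longleftrightarrow> \<bar>t\<bar> < 5/4"
  by (simp add: dom_ball_def)

lemma scale_in_dom_ball:
  assumes "z \<in> dom_ball" "s \<in> {0..1}"
  shows "of_real s * z \<in> dom_ball"
proof -
  have "s * norm z \<le> 1 * norm z" using assms by (intro mult_right_mono) auto
  then show ?thesis using assms by (simp add: dom_ball_def norm_mult)
qed

lemma real_holo_D:
  assumes "real_holo f"
  shows "f holomorphic_on dom_ball" "z \<in> dom_ball \<Longrightarrow> f (cnj z) = cnj (f z)"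
  using assms by (auto simp: real_holo_def)

lemma real_holo_Re:
  assumes "real_holo f" "\<bar>t\<bar> < 5/4"
  shows "f (of_real t) = of_real (Re (f (of_real t)))"
  using real_holo_D(2)[OF assms(1), of "of_real t"] assms(2)
  by (simp add: complex_eq_iff)

lemma real_holo_const: "real_holo (\<lambda>z. of_real c)"
  and real_holo_id: "real_holo (\<lambda>z. z)"
  by (auto simp: real_holo_def)

lemma real_holo_add: "real_holo f \<Longrightarrow> real_holo g \<Longrightarrow> real_holo (\<lambda>z. f z + g z)"
  and real_holo_mult: "real_holo f \<Longrightarrow> real_holo g \<Longrightarrow> real_holo (\<lambda>z. f z * g z)"
  by (auto simp: real_holo_def intro!: holomorphic_intros)

lemma real_holo_inverse:
  "real_holo f \<Longrightarrow> (\<And>z. z \<in> dom_ball \<Longrightarrow> f z \<noteq> 0) \<Longrightarrow> real_holo (\<lambda>z. inverse (f z))"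
  by (auto simp: real_holo_def intro!: holomorphic_intros)

lemma real_holo_divide:
  "real_holo f \<Longrightarrow> real_holo g \<Longrightarrow> (\<And>z. z \<in> dom_ball \<Longrightarrow> g z \<noteq> 0) \<Longrightarrow> real_holo (\<lambda>z. f z / g z)"
  by (auto simp: real_holo_def intro!: holomorphic_intros)

lemma real_holo_deriv_Re:
  assumes "(f has_field_derivative f') (at (of_real t :: complex))"
  shows "((\<lambda>x. Re (f (of_real x))) has_real_derivative Re f') (at t)"
  using assms
  by (metis has_field_derivative_Re has_vector_derivative_real_field)

section \<open>Primitives vanishing at the centre\<close>

text \<open>By the substitution w = s z, \<open>z * avg f z\<close> is the primitive of
  \<open>f\<close> that vanishes at 0. Its zero at 0 is thus split off as an explicit factor, which
  can later be cancelled.\<close>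

definition avg :: "(complex \<Rightarrow> complex) \<Rightarrow> complex \<Rightarrow> complex" where
  "avg f z = integral {0..1} (\<lambda>s. f (of_real s * z))"

lemma avg_integrable:
  assumes "f holomorphic_on dom_ball" "z \<in> dom_ball"
  shows "(\<lambda>s. f (of_real s * z)) integrable_on {0..1}"
proof (rule integrable_continuous_interval)
  have "continuous_on dom_ball f" using assms(1) by (rule holomorphic_on_imp_continuous_on)
  then show "continuous_on {0..1} (\<lambda>s. f (of_real s * z))"
    by (rule continuous_on_compose2) (use assms scale_in_dom_ball in \<open>auto intro!: continuous_intros\<close>)
qed

text \<open>On the convex disc \<open>f\<close> has a primitive \<open>F\<close>, and the
  fundamental theorem along the segment from 0 to z turns \<open>z * avg f z\<close> into
  \<open>F z - F 0\<close>.\<close>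

lemma avg_deriv:
  assumes "f holomorphic_on dom_ball" "z \<in> dom_ball"
  shows "((\<lambda>z. z * avg f z) has_field_derivative f z) (at z)"
proof -
  obtain F where F: "\<And>z. z \<in> dom_ball \<Longrightarrow> (F has_field_derivative f z) (at z within dom_ball)"
    using holomorphic_convex_primitive'[OF convex_dom_ball open_dom_ball assms(1)] by blast
  have F': "(F has_field_derivative f z) (at z)" if "z \<in> dom_ball" for z
    using F[OF that] that by (simp add: at_within_open[of z dom_ball])
  have eq: "z * avg f z = F z - F 0" if z: "z \<in> dom_ball" for z
  proof -
    have "((\<lambda>s. f (of_real s * z) * z) has_integral (F (of_real 1 * z) - F (of_real 0 * z))) {0..1}"
    proof (rule fundamental_theorem_of_calculus)
      fix s :: real assume s: "s \<in> {0..1}"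
      have "((\<lambda>w. F (w * z)) has_field_derivative f (of_real s * z) * z) (at (of_real s))"
        by (rule DERIV_chain2[of F]) (auto intro!: derivative_eq_intros F' scale_in_dom_ball z s)
      then show "((\<lambda>s. F (of_real s * z)) has_vector_derivative f (of_real s * z) * z)
                   (at s within {0..1})"
        by (rule has_vector_derivative_real_field)
    qed simp
    then have "integral {0..1} (\<lambda>s. f (of_real s * z) * z) = F z - F 0"
      by (auto dest: integral_unique)
    then show ?thesis by (simp add: avg_def mult.commute)
  qed
  show ?thesis
  proof (rule has_field_derivative_transform_within_open[of "\<lambda>z. F z - F 0" _ _ dom_ball])
    show "((\<lambda>z. F z - F 0) has_field_derivative f z) (at z)"
      using F'[OF assms(2)] by (auto intro!: derivative_eq_intros)
  qed (use assms eq in auto)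
qed

lemma avg_deriv_affine:
  assumes "f holomorphic_on dom_ball" "z \<in> dom_ball"
  shows "((\<lambda>z. b + d * (z * avg f z)) has_field_derivative d * f z) (at z)"
  using DERIV_add[OF DERIV_const DERIV_cmult[OF avg_deriv[OF assms]], of b d] by simp

text \<open>Dividing the primitive by \<open>z\<close> would leave the point 0 open; differentiation
  under the integral sign treats all points alike.\<close>

lemma avg_holo:
  assumes "f holomorphic_on dom_ball"
  shows "avg f holomorphic_on dom_ball"
proof -
  have "(\<lambda>z. integral (cbox 0 1) (\<lambda>s::real. f (of_real s * z))) holomorphic_on dom_ball"
  proof (rule leibniz_rule_holomorphic[where fx = "\<lambda>z s. deriv f (of_real s * z) * of_real s"])
    fix z and s :: real assume *: "z \<in> dom_ball" "s \<in> cbox 0 1"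
    have "(f has_field_derivative deriv f (of_real s * z)) (at (of_real s * z))"
      using assms * scale_in_dom_ball[of z s] by (intro holomorphic_derivI) auto
    then show "((\<lambda>z. f (of_real s * z)) has_field_derivative deriv f (of_real s * z) * of_real s)
                 (at z within dom_ball)"
      by (rule DERIV_chain2) (auto intro!: derivative_eq_intros)
  next
    fix z assume "z \<in> dom_ball"
    then show "(\<lambda>s::real. f (of_real s * z)) integrable_on cbox 0 1"
      using avg_integrable[OF assms] by simp
  next
    have "continuous_on dom_ball (deriv f)"
      using assms by (intro holomorphic_on_imp_continuous_on holomorphic_deriv) auto
    then have "continuous_on (dom_ball \<times> {0..1}) (\<lambda>p. deriv f (of_real (snd p) * fst p))"
      by (rule continuous_on_compose2)
         (use scale_in_dom_ball in \<open>auto intro!: continuous_intros\<close>)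
    then show "continuous_on (dom_ball \<times> cbox 0 1)
                 (\<lambda>(z, s::real). deriv f (of_real s * z) * of_real s)"
      by (auto simp: case_prod_unfold intro!: continuous_intros)
  qed simp
  then show ?thesis by (simp add: avg_def[abs_def])
qed

lemma real_holo_avg:
  assumes "real_holo f"
  shows "real_holo (avg f)"
  unfolding real_holo_def
proof (intro conjI ballI)
  show "avg f holomorphic_on dom_ball" using assms by (intro avg_holo real_holo_D)
  fix z assume z: "z \<in> dom_ball"
  have "f (of_real s * cnj z) = cnj (f (of_real s * z))" if "s \<in> {0..1}" for s
    using real_holo_D(2)[OF assms scale_in_dom_ball[OF z that]] by simp
  then show "avg f (cnj z) = cnj (avg f z)"
    unfolding avg_def integral_cnj by (intro integral_cong)
qed

lemma avg_bound:
  assumes "f holomorphic_on dom_ball" "\<And>z. z \<in> dom_ball \<Longrightarrow> norm (f z) \<le> C" "z \<in> dom_ball"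
  shows "norm (avg f z) \<le> C"
proof -
  have "norm (integral (cbox 0 1) (\<lambda>s::real. f (of_real s * z))) \<le> C * measure lborel (cbox 0 (1::real))"
  proof (rule has_integral_bound)
    show "0 \<le> C" using assms(2)[OF assms(3)] norm_ge_zero order_trans by blast
    show "((\<lambda>s::real. f (of_real s * z)) has_integral integral (cbox 0 1) (\<lambda>s::real. f (of_real s * z)))
            (cbox 0 1)"
      using avg_integrable[OF assms(1,3)] by (simp add: has_integral_iff)
  qed (use assms scale_in_dom_ball in auto)
  then show ?thesis by (simp add: avg_def)
qed

lemma avg_diff:
  assumes "f holomorphic_on dom_ball" "g holomorphic_on dom_ball" "z \<in> dom_ball"
  shows "avg f z - avg g z = avg (\<lambda>z. f z - g z) z"
  unfolding avg_def by (intro integral_diff[symmetric] avg_integrable assms)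

subsection \<open>Lipschitz functionals\<close>

text \<open>The closed unit ball of the sup norm, on which the contraction will act.\<close>

definition unit_family :: "('i \<Rightarrow> complex \<Rightarrow> complex) set" where
  "unit_family = {u. \<forall>i. real_holo (u i) \<and> (\<forall>z\<in>dom_ball. norm (u i z) \<le> 1)}"

lemma unit_familyD:
  assumes "u \<in> unit_family"
  shows "real_holo (u i)" "z \<in> dom_ball \<Longrightarrow> norm (u i z) \<le> 1"
  using assms by (auto simp: unit_family_def)

text \<open>Holomorphy survives by Weierstrass' theorem on locally uniform limits; symmetry and the
  norm bound survive pointwise.\<close>

lemma unit_family_closed:
  assumes "\<And>n. f n \<in> unit_family"
    and lim: "uniform_limit (UNIV \<times> dom_ball) (\<lambda>n (i, x). f n i x) (\<lambda>(i, x). g i x) sequentially"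
  shows "g \<in> unit_family"
proof -
  have lim_i: "uniform_limit dom_ball (\<lambda>n. f n i) (g i) sequentially" for i
    using uniform_limit_compose'[OF lim, of "\<lambda>z. (i, z)" dom_ball] by auto
  have pw: "(\<lambda>n. f n i z) \<longlonglongrightarrow> g i z" if "z \<in> dom_ball" for i z
    by (rule tendsto_uniform_limitI[OF lim_i that])
  have "g i holomorphic_on dom_ball" for i
  proof (rule holomorphic_uniform_sequence[of _ "\<lambda>n. f n i"])
    fix x assume "x \<in> dom_ball"
    then obtain d where "d > 0" "cball x d \<subseteq> dom_ball"
      using open_contains_cball[of dom_ball] by auto
    then show "\<exists>d>0. cball x d \<subseteq> dom_ball \<and> uniform_limit (cball x d) (\<lambda>n. f n i) (g i) sequentially"
      using uniform_limit_on_subset[OF lim_i] by blast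
  qed (use unit_familyD[OF assms(1)] in \<open>auto simp: real_holo_def\<close>)
  moreover have "g i (cnj z) = cnj (g i z)" if "z \<in> dom_ball" for i z
  proof (rule LIMSEQ_unique)
    show "(\<lambda>n. f n i (cnj z)) \<longlonglongrightarrow> g i (cnj z)" using that by (intro pw) simp
    have "f n i (cnj z) = cnj (f n i z)" for n
      using real_holo_D(2)[OF unit_familyD(1)[OF assms(1)] that] .
    then show "(\<lambda>n. f n i (cnj z)) \<longlonglongrightarrow> cnj (g i z)"
      using tendsto_cnj[OF pw[OF that]] by simp
  qed
  moreover have "norm (g i z) \<le> 1" if "z \<in> dom_ball" for i z
    by (rule Lim_norm_ubound[OF _ pw[OF that]])
       (auto intro!: always_eventually unit_familyD(2)[OF assms(1)] that)
  ultimately show ?thesis by (auto simp: unit_family_def real_holo_def)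
qed

text \<open>
  Functionals of the unknowns that are bounded and Lipschitz in the sup norm, uniformly in the
  parameter \<open>0 < e \<le> e\<^sub>0\<close>: a single constant serves both purposes.
\<close>

definition lip_functional ::
  "real \<Rightarrow> (real \<Rightarrow> ('i \<Rightarrow> complex \<Rightarrow> complex) \<Rightarrow> complex \<Rightarrow> complex) \<Rightarrow> real \<Rightarrow> bool" where
  "lip_functional e\<^sub>0 \<Phi> C \<longleftrightarrow>
     (\<forall>e u. 0 < e \<longrightarrow> e \<le> e\<^sub>0 \<longrightarrow> u \<in> unit_family \<longrightarrow>
        real_holo (\<Phi> e u) \<and>
        (\<forall>z\<in>dom_ball. norm (\<Phi> e u z) \<le> C) \<and>
        (\<forall>w\<in>unit_family. \<forall>d. (\<forall>i. \<forall>z\<in>dom_ball. norm (u i z - w i z) \<le> d) \<longrightarrow>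
           (\<forall>z\<in>dom_ball. norm (\<Phi> e u z - \<Phi> e w z) \<le> C * d)))"

definition nice where "nice e\<^sub>0 \<Phi> \<longleftrightarrow> (\<exists>C. lip_functional e\<^sub>0 \<Phi> C)"

lemma lip_functionalD:
  assumes "lip_functional e\<^sub>0 \<Phi> C" "0 < e" "e \<le> e\<^sub>0" "u \<in> unit_family"
  shows "real_holo (\<Phi> e u)"
    and "z \<in> dom_ball \<Longrightarrow> norm (\<Phi> e u z) \<le> C"
    and "\<lbrakk>w \<in> unit_family; \<And>i z. z \<in> dom_ball \<Longrightarrow> norm (u i z - w i z) \<le> d; z \<in> dom_ball\<rbrakk>
           \<Longrightarrow> norm (\<Phi> e u z - \<Phi> e w z) \<le> C * d"
  using assms unfolding lip_functional_def by blast+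

lemma lip_functionalI:
  fixes \<Phi> :: "real \<Rightarrow> ('i \<Rightarrow> complex \<Rightarrow> complex) \<Rightarrow> complex \<Rightarrow> complex"
  assumes "\<And>e u. \<lbrakk>0 < e; e \<le> e\<^sub>0; u \<in> unit_family\<rbrakk> \<Longrightarrow> real_holo (\<Phi> e u)"
    and "\<And>e u z. \<lbrakk>0 < e; e \<le> e\<^sub>0; u \<in> unit_family; z \<in> dom_ball\<rbrakk> \<Longrightarrow> norm (\<Phi> e u z) \<le> C"
    and "\<And>e u w d z. \<lbrakk>0 < e; e \<le> e\<^sub>0; u \<in> unit_family; w \<in> unit_family; 0 \<le> d;
           \<And>i z. z \<in> dom_ball \<Longrightarrow> norm (u i z - w i z) \<le> d; z \<in> dom_ball\<rbrakk>
           \<Longrightarrow> norm (\<Phi> e u z - \<Phi> e w z) \<le> C * d"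
  shows "lip_functional e\<^sub>0 \<Phi> C"
  unfolding lip_functional_def
proof (intro allI impI conjI ballI)
  fix e and u w :: "'i \<Rightarrow> complex \<Rightarrow> complex" and d z
  assume *: "0 < e" "e \<le> e\<^sub>0" "u \<in> unit_family" "w \<in> unit_family"
    "\<forall>i. \<forall>z\<in>dom_ball. norm (u i z - w i z) \<le> d" "z \<in> dom_ball"
  then have "0 \<le> d" using norm_ge_zero order_trans by blast
  with * show "norm (\<Phi> e u z - \<Phi> e w z) \<le> C * d" using assms(3) by blast
qed (use assms(1,2) in blast)+

lemma lip_functional_mono:
  assumes "lip_functional e\<^sub>0 \<Phi> C" "C \<le> C'" "e\<^sub>1 \<le> e\<^sub>0"
  shows "lip_functional e\<^sub>1 \<Phi> C'"
proof (rule lip_functionalI)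
  fix e and u :: "'a \<Rightarrow> complex \<Rightarrow> complex" and z assume "0 < e" "e \<le> e\<^sub>1" "u \<in> unit_family" "z \<in> dom_ball"
  then show "norm (\<Phi> e u z) \<le> C'"
    using lip_functionalD(2)[OF assms(1), of e u z] assms(2,3) by linarith
next
  fix e and u w :: "'a \<Rightarrow> complex \<Rightarrow> complex" and d z
  assume *: "0 < e" "e \<le> e\<^sub>1" "u \<in> unit_family" "w \<in> unit_family" "0 \<le> d"
    "\<And>i z. z \<in> dom_ball \<Longrightarrow> norm (u i z - w i z) \<le> d" "z \<in> dom_ball"
  have "norm (\<Phi> e u z - \<Phi> e w z) \<le> C * d"
    by (rule lip_functionalD(3)[OF assms(1)]) (use * assms(3) in auto)
  also have "\<dots> \<le> C' * d" using * assms(2) by (intro mult_right_mono)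
  finally show "norm (\<Phi> e u z - \<Phi> e w z) \<le> C' * d" .
qed (use lip_functionalD(1)[OF assms(1)] assms(3) in auto)

lemma niceE:
  assumes "nice e\<^sub>0 \<Phi>"
  obtains C where "C \<ge> 0" "lip_functional e\<^sub>0 \<Phi> C"
  using assms lip_functional_mono[of e\<^sub>0 \<Phi> _ _ e\<^sub>0] unfolding nice_def
  by (metis max.cobounded1 max.cobounded2 order_refl)

section \<open>Closure properties of bounded Lipschitz functionals\<close>

lemma nice_of_real: "nice e\<^sub>0 (\<lambda>e u z. of_real c)"
  unfolding nice_def
  by (rule exI[of _ "\<bar>c\<bar>"], rule lip_functionalI) (auto simp: real_holo_const)

lemma nice_id: "nice e\<^sub>0 (\<lambda>e u z. z)"
  unfolding nice_def
  by (rule exI[of _ "5/4"], rule lip_functionalI) (auto simp: real_holo_id dom_ball_def)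

lemma nice_parameter: "nice e\<^sub>0 (\<lambda>e u z. of_real e)"
  unfolding nice_def
  by (rule exI[of _ "\<bar>e\<^sub>0\<bar>"], rule lip_functionalI) (auto simp: real_holo_const)

lemma nice_unknown: "nice e\<^sub>0 (\<lambda>e u. u i)"
  unfolding nice_def
  by (rule exI[of _ 1], rule lip_functionalI) (auto simp: unit_familyD)

lemma nice_add:
  assumes "nice e\<^sub>0 \<Phi>" "nice e\<^sub>0 \<Psi>"
  shows "nice e\<^sub>0 (\<lambda>e u z. \<Phi> e u z + \<Psi> e u z)"
proof -
  from assms obtain A B where A: "lip_functional e\<^sub>0 \<Phi> A" and B: "lip_functional e\<^sub>0 \<Psi> B"
    unfolding nice_def by blast
  have "lip_functional e\<^sub>0 (\<lambda>e u z. \<Phi> e u z + \<Psi> e u z) (A + B)"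
  proof (rule lip_functionalI)
    fix e and u :: "'a \<Rightarrow> complex \<Rightarrow> complex" and z assume "0 < e" "e \<le> e\<^sub>0" "u \<in> unit_family" "z \<in> dom_ball"
    then show "norm (\<Phi> e u z + \<Psi> e u z) \<le> A + B"
      by (intro norm_triangle_mono lip_functionalD(2)[OF A] lip_functionalD(2)[OF B])
  next
    fix e and u w :: "'a \<Rightarrow> complex \<Rightarrow> complex" and d z
    assume *: "0 < e" "e \<le> e\<^sub>0" "u \<in> unit_family" "w \<in> unit_family" "0 \<le> d"
      "\<And>i z. z \<in> dom_ball \<Longrightarrow> norm (u i z - w i z) \<le> d" "z \<in> dom_ball"
    have "norm ((\<Phi> e u z - \<Phi> e w z) + (\<Psi> e u z - \<Psi> e w z)) \<le> A * d + B * d"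
      by (intro norm_triangle_mono lip_functionalD(3)[OF A] lip_functionalD(3)[OF B] *)
    then show "norm ((\<Phi> e u z + \<Psi> e u z) - (\<Phi> e w z + \<Psi> e w z)) \<le> (A + B) * d"
      by (simp add: algebra_simps)
  qed (auto intro: real_holo_add lip_functionalD(1)[OF A] lip_functionalD(1)[OF B])
  then show ?thesis unfolding nice_def by blast
qed

lemma nice_mult:
  assumes "nice e\<^sub>0 \<Phi>" "nice e\<^sub>0 \<Psi>"
  shows "nice e\<^sub>0 (\<lambda>e u z. \<Phi> e u z * \<Psi> e u z)"
proof -
  from assms obtain A B where A: "lip_functional e\<^sub>0 \<Phi> A" and B: "lip_functional e\<^sub>0 \<Psi> B"
    and nn: "A \<ge> 0" "B \<ge> 0"
    by (metis niceE)
  \<comment> \<open>The bound is \<open>A * B\<close>, but the product rule gives the Lipschitz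
    constant \<open>A * B + A * B\<close>; the larger one serves for both.\<close>
  have "lip_functional e\<^sub>0 (\<lambda>e u z. \<Phi> e u z * \<Psi> e u z) (2 * A * B)"
  proof (rule lip_functionalI)
    fix e and u :: "'a \<Rightarrow> complex \<Rightarrow> complex" and z assume "0 < e" "e \<le> e\<^sub>0" "u \<in> unit_family" "z \<in> dom_ball"
    then have "norm (\<Phi> e u z * \<Psi> e u z) \<le> A * B"
      unfolding norm_mult
      by (intro mult_mono lip_functionalD(2)[OF A] lip_functionalD(2)[OF B] nn norm_ge_zero)
    also have "\<dots> \<le> 2 * A * B" using nn by simp
    finally show "norm (\<Phi> e u z * \<Psi> e u z) \<le> 2 * A * B" .
  next
    fix e and u w :: "'a \<Rightarrow> complex \<Rightarrow> complex" and d z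
    assume *: "0 < e" "e \<le> e\<^sub>0" "u \<in> unit_family" "w \<in> unit_family" "0 \<le> d"
      "\<And>i z. z \<in> dom_ball \<Longrightarrow> norm (u i z - w i z) \<le> d" "z \<in> dom_ball"
    have "norm (\<Phi> e u z * (\<Psi> e u z - \<Psi> e w z) + (\<Phi> e u z - \<Phi> e w z) * \<Psi> e w z)
            \<le> A * (B * d) + (A * d) * B"
      by (intro norm_triangle_mono norm_mult_ineq[THEN order_trans] mult_mono
            lip_functionalD(2,3)[OF A] lip_functionalD(2,3)[OF B] * nn norm_ge_zero mult_nonneg_nonneg)
    then show "norm (\<Phi> e u z * \<Psi> e u z - \<Phi> e w z * \<Psi> e w z) \<le> 2 * A * B * d"
      by (simp add: algebra_simps)
  qed (auto intro: real_holo_mult lip_functionalD(1)[OF A] lip_functionalD(1)[OF B])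
  then show ?thesis unfolding nice_def by blast
qed

lemma nice_uminus: "nice e\<^sub>0 \<Phi> \<Longrightarrow> nice e\<^sub>0 (\<lambda>e u z. - \<Phi> e u z)"
  using nice_mult[OF nice_of_real[of e\<^sub>0 "- 1"], of \<Phi>] by simp

lemma nice_diff: "nice e\<^sub>0 \<Phi> \<Longrightarrow> nice e\<^sub>0 \<Psi> \<Longrightarrow> nice e\<^sub>0 (\<lambda>e u z. \<Phi> e u z - \<Psi> e u z)"
  using nice_add[OF _ nice_uminus, of e\<^sub>0 \<Phi> \<Psi>] by simp

lemma nice_1: "nice e\<^sub>0 (\<lambda>e u z. 1)"
  using nice_of_real[of e\<^sub>0 1] by simp

lemma nice_0: "nice e\<^sub>0 (\<lambda>e u z. 0)"
  using nice_of_real[of e\<^sub>0 0] by simp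

lemma nice_power: "nice e\<^sub>0 \<Phi> \<Longrightarrow> nice e\<^sub>0 (\<lambda>e u z. \<Phi> e u z ^ n)"
  by (induction n) (auto intro: nice_1 nice_mult)

lemma nice_sum: "(\<And>j. j \<in> J \<Longrightarrow> nice e\<^sub>0 (\<Phi> j)) \<Longrightarrow> nice e\<^sub>0 (\<lambda>e u z. \<Sum>j\<in>J. \<Phi> j e u z)"
  by (induction J rule: infinite_finite_induct) (auto intro: nice_0 nice_add)

lemma nice_avg:
  assumes "nice e\<^sub>0 \<Phi>"
  shows "nice e\<^sub>0 (\<lambda>e u. avg (\<Phi> e u))"
proof -
  from assms obtain A where A: "lip_functional e\<^sub>0 \<Phi> A" unfolding nice_def by blast
  have hol: "\<Phi> e u holomorphic_on dom_ball" if "0 < e" "e \<le> e\<^sub>0" "u \<in> unit_family" for e u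
    using lip_functionalD(1)[OF A that] by (rule real_holo_D)
  have "lip_functional e\<^sub>0 (\<lambda>e u. avg (\<Phi> e u)) A"
  proof (rule lip_functionalI)
    fix e and u :: "'a \<Rightarrow> complex \<Rightarrow> complex" and z assume "0 < e" "e \<le> e\<^sub>0" "u \<in> unit_family" "z \<in> dom_ball"
    then show "norm (avg (\<Phi> e u) z) \<le> A"
      by (intro avg_bound hol lip_functionalD(2)[OF A])
  next
    fix e and u w :: "'a \<Rightarrow> complex \<Rightarrow> complex" and d z
    assume *: "0 < e" "e \<le> e\<^sub>0" "u \<in> unit_family" "w \<in> unit_family" "0 \<le> d"
      "\<And>i z. z \<in> dom_ball \<Longrightarrow> norm (u i z - w i z) \<le> d" "z \<in> dom_ball"
    have "norm (avg (\<lambda>z. \<Phi> e u z - \<Phi> e w z) z) \<le> A * d"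
      by (intro avg_bound holomorphic_on_diff hol lip_functionalD(3)[OF A] *)
    then show "norm (avg (\<Phi> e u) z - avg (\<Phi> e w) z) \<le> A * d"
      using * by (simp add: avg_diff hol)
  qed (auto intro: real_holo_avg lip_functionalD(1)[OF A])
  then show ?thesis unfolding nice_def by blast
qed

text \<open>The identity 1/x - 1/y = -(x - y)/(x y) gives the Lipschitz estimate, provided the lower
  bound \<open>b\<close> is uniform in the parameter and the unknowns.\<close>

lemma nice_inverse:
  assumes "nice e\<^sub>0 \<Phi>" "b > 0"
    and lower: "\<And>e u z. \<lbrakk>0 < e; e \<le> e\<^sub>0; u \<in> unit_family; z \<in> dom_ball\<rbrakk> \<Longrightarrow> norm (\<Phi> e u z) \<ge> b"
  shows "nice e\<^sub>0 (\<lambda>e u z. inverse (\<Phi> e u z))"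
proof -
  from assms(1) obtain A where A: "lip_functional e\<^sub>0 \<Phi> A" "A \<ge> 0" by (metis niceE)
  have nz: "\<Phi> e u z \<noteq> 0" if "0 < e" "e \<le> e\<^sub>0" "u \<in> unit_family" "z \<in> dom_ball" for e u z
    using lower[OF that] \<open>b > 0\<close> by auto
  have inv: "norm (inverse (\<Phi> e u z)) \<le> inverse b"
    if "0 < e" "e \<le> e\<^sub>0" "u \<in> unit_family" "z \<in> dom_ball" for e u z
    using lower[OF that] \<open>b > 0\<close> by (simp add: norm_inverse le_imp_inverse_le)
  \<comment> \<open>The first summand is the sup bound, the second the Lipschitz constant.\<close>
  have "lip_functional e\<^sub>0 (\<lambda>e u z. inverse (\<Phi> e u z)) (inverse b + inverse b * A * inverse b)"
  proof (rule lip_functionalI)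
    fix e and u :: "'a \<Rightarrow> complex \<Rightarrow> complex" and z assume *: "0 < e" "e \<le> e\<^sub>0" "u \<in> unit_family" "z \<in> dom_ball"
    have "inverse b * A * inverse b \<ge> 0" using A(2) \<open>b > 0\<close> by simp
    then show "norm (inverse (\<Phi> e u z)) \<le> inverse b + inverse b * A * inverse b"
      using inv[OF *] by linarith
  next
    fix e and u w :: "'a \<Rightarrow> complex \<Rightarrow> complex" and d z
    assume *: "0 < e" "e \<le> e\<^sub>0" "u \<in> unit_family" "w \<in> unit_family" "0 \<le> d"
      "\<And>i z. z \<in> dom_ball \<Longrightarrow> norm (u i z - w i z) \<le> d" "z \<in> dom_ball"
    have "inverse (\<Phi> e u z) - inverse (\<Phi> e w z)
            = - (inverse (\<Phi> e u z) * (\<Phi> e u z - \<Phi> e w z) * inverse (\<Phi> e w z))"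
      using * by (intro inverse_diff_inverse nz)
    also have "norm \<dots> \<le> inverse b * (A * d) * inverse b"
      unfolding norm_minus_cancel norm_mult
      using A(2) *(5) \<open>b > 0\<close>
      by (intro mult_mono inv lip_functionalD(3)[OF A(1)] * norm_ge_zero mult_nonneg_nonneg) auto
    also have "\<dots> \<le> (inverse b + inverse b * A * inverse b) * d"
      using * \<open>b > 0\<close> by (simp add: algebra_simps)
    finally show "norm (inverse (\<Phi> e u z) - inverse (\<Phi> e w z))
                    \<le> (inverse b + inverse b * A * inverse b) * d" .
  qed (use nz in \<open>auto intro!: real_holo_inverse lip_functionalD(1)[OF A(1)]\<close>)
  then show ?thesis unfolding nice_def by blast
qed

lemmas nice_intros =
  nice_1 nice_0 nice_of_real nice_parameter nice_id nice_unknown nice_add nice_diff nice_uminus nice_mult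
  nice_power nice_sum nice_avg

text \<open>The prefactor \<open>e\<close> turns boundedness into a contraction.\<close>

lemma small_nice_fixpoint:
  fixes \<Phi> :: "'i \<Rightarrow> real \<Rightarrow> ('i \<Rightarrow> complex \<Rightarrow> complex) \<Rightarrow> complex \<Rightarrow> complex"
  assumes "finite I" "\<And>i. i \<in> I \<Longrightarrow> nice e\<^sub>0 (\<Phi> i)" "\<And>i. i \<notin> I \<Longrightarrow> \<Phi> i = (\<lambda>e u z. 0)" "e\<^sub>0 > 0"
  obtains e\<^sub>1 where "0 < e\<^sub>1" "e\<^sub>1 \<le> e\<^sub>0"
    "\<And>e. \<lbrakk>0 < e; e \<le> e\<^sub>1\<rbrakk> \<Longrightarrow> \<exists>u\<in>unit_family. \<forall>i. \<forall>z\<in>dom_ball. of_real e * \<Phi> i e u z = u i z"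
proof -
  have "\<forall>i\<in>I. \<exists>C\<ge>0. lip_functional e\<^sub>0 (\<Phi> i) C"
    using assms(2) niceE by metis
  then obtain C where C: "\<And>i. i \<in> I \<Longrightarrow> C i \<ge> 0" "\<And>i. i \<in> I \<Longrightarrow> lip_functional e\<^sub>0 (\<Phi> i) (C i)"
    by metis
  \<comment> \<open>One constant for all indices; the summand 1 keeps it positive, so that 1 / (2 B)
    makes sense.\<close>
  define B where "B = 1 + (\<Sum>i\<in>I. C i)"
  have "B \<ge> 1" unfolding B_def using C(1) by (simp add: sum_nonneg)
  have lip: "lip_functional e\<^sub>0 (\<Phi> i) B" for i
  proof (cases "i \<in> I")
    case True
    then have "C i \<le> (\<Sum>i\<in>I. C i)" using assms(1) C(1) by (intro member_le_sum) auto
    then have "C i \<le> B" by (simp add: B_def)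
    then show ?thesis by (rule lip_functional_mono[OF C(2)[OF True]]) simp
  next
    case False
    show ?thesis unfolding assms(3)[OF False]
      by (rule lip_functionalI) (use \<open>B \<ge> 1\<close> real_holo_const[of 0] in auto)
  qed
  show ?thesis
  proof (rule that[of "min e\<^sub>0 (1 / (2 * B))"])
    fix e assume e: "0 < e" "e \<le> min e\<^sub>0 (1 / (2 * B))"
    \<comment> \<open>This inequality serves twice: the map preserves the unit ball, and it halves
      distances.\<close>
    then have eB: "e * B \<le> 1/2" using \<open>B \<ge> 1\<close> by (auto simp: field_simps)
    have e0: "e \<le> e\<^sub>0" using e by simp
    let ?K = "unit_family :: ('i \<Rightarrow> complex \<Rightarrow> complex) set"
    obtain u where "u \<in> ?K" "\<And>i z. z \<in> dom_ball \<Longrightarrow> of_real e * \<Phi> i e u z = u i z"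
    proof (rule uniform_contraction_fixpoint
        [of "\<lambda>i z. 0" ?K "\<lambda>u i z. of_real e * \<Phi> i e u z" dom_ball 2])
      show "(\<lambda>i z. 0) \<in> ?K" using real_holo_const[of 0] by (simp add: unit_family_def)
    next
      fix u assume u: "u \<in> ?K"
      show "(\<lambda>i z. of_real e * \<Phi> i e u z) \<in> ?K"
        unfolding unit_family_def
      proof (intro CollectI allI conjI ballI)
        fix i show "real_holo (\<lambda>z. of_real e * \<Phi> i e u z)"
          by (intro real_holo_mult real_holo_const lip_functionalD(1)[OF lip] e e0 u)
        fix z :: complex assume z: "z \<in> dom_ball"
        have "e * norm (\<Phi> i e u z) \<le> e * B"
          using e by (intro mult_left_mono lip_functionalD(2)[OF lip] e0 u z) auto
        also have "\<dots> \<le> 1" using eB by simp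
        finally show "norm (of_real e * \<Phi> i e u z) \<le> 1" using e by (simp add: norm_mult)
      qed
    next
      fix u w d i and x :: complex
      assume *: "u \<in> ?K" "w \<in> ?K" "\<And>i x. x \<in> dom_ball \<Longrightarrow> dist (u i x) (w i x) \<le> d" "x \<in> dom_ball"
      have "0 \<le> d" using *(3)[OF *(4), of i] zero_le_dist order_trans by blast
      have "e * norm (\<Phi> i e u x - \<Phi> i e w x) \<le> e * (B * d)"
        using e * by (intro mult_left_mono lip_functionalD(3)[OF lip] e0) (auto simp: dist_norm)
      also have "\<dots> \<le> d / 2" using mult_right_mono[OF eB \<open>0 \<le> d\<close>] by simp
      finally show "dist (of_real e * \<Phi> i e u x) (of_real e * \<Phi> i e w x) \<le> d / 2"
        using e by (simp add: dist_norm right_diff_distrib[symmetric] norm_mult)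
    next
      fix u w i and x :: complex
      assume *: "u \<in> ?K" "w \<in> ?K" "x \<in> dom_ball"
      show "dist (u i x) (w i x) \<le> 2"
        using norm_triangle_ineq4[of "u i x" "w i x"] unit_familyD(2)[OF *(1,3), of i]
          unit_familyD(2)[OF *(2,3), of i] by (simp add: dist_norm)
    qed (use unit_family_closed in blast)+
    then show "\<exists>u\<in>unit_family. \<forall>i. \<forall>z\<in>dom_ball. of_real e * \<Phi> i e u z = u i z" by blast
  qed (use assms(4) \<open>B \<ge> 1\<close> in auto)
qed

subsection \<open>The compactified exterior\<close>

text \<open>
  The field equations in the compactified coordinate \<open>t = 1 - a/r\<close>, which maps the exterior
  \<open>[a, \<infinity>)\<close> onto \<open>[0, 1)\<close>. Here \<open>n = 2 m S / a\<close> and \<open>v j = d\<omega>\<^sub>j/dt\<close>; in terms of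
  \<open>Y = S \<mu> (1 - t)\<^sup>2\<close> the gauge equation is \<open>(Y v\<^sub>j)' = - S W\<^sub>j \<omega>\<^sub>j\<close>.
\<close>

lemma compactified_solution:
  fixes a k \<Lambda> c s :: real and N :: nat and S n H P Y Y' :: "real \<Rightarrow> real"
    and \<omega> v v' :: "nat \<Rightarrow> real \<Rightarrow> real"
  assumes a: "a > 0" and s: "s > 0" and c: "\<Lambda> = - 3 * c / a^2"
    and H: "\<And>t. H t = gauge_G N (\<lambda>j. v j t)"
    and P: "\<And>t. P t = (\<Sum>j\<in>{1..N}. ((\<omega> j t)^2 - (\<omega> (j - 1) t)^2 - k * (real N + 1 - 2 * real j))^2)"
    and S_pos: "\<And>t. \<lbrakk>0 \<le> t; t < 1\<rbrakk> \<Longrightarrow> S t > 0"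
    and S: "\<And>t. \<lbrakk>0 \<le> t; t < 1\<rbrakk> \<Longrightarrow> (S has_real_derivative S t * (2 / a^2 * (1 - t)^3 * H t)) (at t)"
    and n: "\<And>t. \<lbrakk>0 \<le> t; t < 1\<rbrakk> \<Longrightarrow>
              (n has_real_derivative S t * (2 / a^2 * (k * (1 - t)^2 + c) * H t + P t / (2 * a^2))) (at t)"
    and \<omega>: "\<And>j t. \<lbrakk>j \<in> {1..N-1}; 0 \<le> t; t < 1\<rbrakk> \<Longrightarrow> (\<omega> j has_real_derivative v j t) (at t)"
    and v: "\<And>j t. \<lbrakk>j \<in> {1..N-1}; 0 \<le> t; t < 1\<rbrakk> \<Longrightarrow> (v j has_real_derivative v' j t) (at t)"
    and Y: "\<And>t. Y t = S t * (k * (1 - t)^2 + c) - (1 - t)^3 * n t"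
    and Y': "\<And>t. \<lbrakk>0 \<le> t; t < 1\<rbrakk> \<Longrightarrow> (Y has_real_derivative Y' t) (at t)"
    and gauge: "\<And>j t. \<lbrakk>j \<in> {1..N-1}; 0 \<le> t; t < 1\<rbrakk> \<Longrightarrow>
              Y t * v' j t + Y' t * v j t = - (S t * gauge_W k (\<lambda>i. \<omega> i t) j * \<omega> j t)"
    and zero: "\<And>t. \<omega> 0 t = 0" "\<And>t. \<omega> N t = 0"
  shows "sun_eym_solution_on {a..} N k \<Lambda> (\<lambda>r. a / 2 * (n (1 - a / r) / S (1 - a / r)))
           (\<lambda>r. S (1 - a / r) / s) (\<lambda>j r. \<omega> j (1 - a / r))"
proof -
  let ?t = "\<lambda>r. 1 - a / r"
  define S' where "S' t = S t * (2 / a^2 * (1 - t)^3 * H t)" for t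
  define n' where "n' t = S t * (2 / a^2 * (k * (1 - t)^2 + c) * H t + P t / (2 * a^2))" for t
  define dm where "dm r = a / 2 * ((n' (?t r) * S (?t r) - n (?t r) * S' (?t r)) / (S (?t r))^2) * (a / r^2)" for r
  define dS where "dS r = S' (?t r) * (a / r^2) / s" for r
  define dw where "dw j r = v j (?t r) * (a / r^2)" for j r
  define ddw where "ddw j r = v' j (?t r) * (a / r^2)^2 + v j (?t r) * (- 2 * a / r^3)" for j r
  \<comment> \<open>\<open>Y'\<close> is given only as some derivative of \<open>Y\<close>;
    uniqueness of derivatives expresses it through those of \<open>S\<close> and
    \<open>n\<close>.\<close>
  have Y'_eq: "Y' t = S' t * (k * (1 - t)^2 + c) - 2 * k * (1 - t) * S t + 3 * (1 - t)^2 * n t - (1 - t)^3 * n' t"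
    if "0 \<le> t" "t < 1" for t
  proof (rule DERIV_unique[OF Y'[OF that]])
    show "(Y has_real_derivative S' t * (k * (1 - t)^2 + c) - 2 * k * (1 - t) * S t
             + 3 * (1 - t)^2 * n t - (1 - t)^3 * n' t) (at t)"
      unfolding Y[abs_def] S'_def n'_def
      by (rule derivative_eq_intros S n that refl)+ (simp add: algebra_simps)
  qed
  have main: "((\<lambda>r. a / 2 * (n (?t r) / S (?t r))) has_real_derivative dm r) (at r within {a..}) \<and>
        ((\<lambda>r. S (?t r) / s) has_real_derivative dS r) (at r within {a..}) \<and>
        (\<forall>j\<in>{1..N-1}.
          ((\<lambda>r. \<omega> j (?t r)) has_real_derivative dw j r) (at r within {a..}) \<and>
          (dw j has_real_derivative ddw j r) (at r within {a..}) \<and>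
          r^2 * metric_mu k \<Lambda> (\<lambda>r. a / 2 * (n (?t r) / S (?t r))) r * ddw j r
            + (2 * (a / 2 * (n (?t r) / S (?t r))) - 2 * r^3 * p_theta N k (\<lambda>i. \<omega> i (?t r)) r
                 - 2 * \<Lambda> * r^3 / 3) * dw j r
            + gauge_W k (\<lambda>i. \<omega> i (?t r)) j * \<omega> j (?t r) = 0)
     \<and> dm r = metric_mu k \<Lambda> (\<lambda>r. a / 2 * (n (?t r) / S (?t r))) r * gauge_G N (\<lambda>i. dw i r)
                 + r^2 * p_theta N k (\<lambda>i. \<omega> i (?t r)) r
     \<and> dS r / (S (?t r) / s) = 2 * gauge_G N (\<lambda>i. dw i r) / r"
    if r: "r \<in> {a..}" for r
  proof -
    \<comment> \<open>In x = a/r = 1 - t and q = n/S = 2m/a every coefficient is rational: 2m/r = q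
      x and -\<Lambda> r^2/3 = c/x^2.\<close>
    define x where "x = a / r"
    define t where "t = 1 - x"
    define q where "q = n t / S t"
    have pos: "r > 0" "x > 0" "x \<le> 1" using a r by (auto simp: x_def)
    have r_eq: "r = a / x" using a pos by (simp add: x_def)
    have t: "?t r = t" "1 - t = x" "0 \<le> t" "t < 1" using pos by (auto simp: t_def x_def)
    have St: "S t > 0" using S_pos t by blast
    have n_eq: "n t = q * S t" using St by (simp add: q_def)
    have dt: "(?t has_real_derivative a / r^2) (at r)"
      using pos by (auto intro!: derivative_eq_intros simp: power2_eq_square)
    have chain: "((\<lambda>r. f (?t r)) has_real_derivative f' * (a / r^2)) (at r)"
      if "(f has_real_derivative f') (at t)" for f f'
      using DERIV_chain2[of f f' ?t r "a / r^2"] that dt t by simp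
    have mu: "metric_mu k \<Lambda> (\<lambda>r. a / 2 * (n (?t r) / S (?t r))) r = k - q * x + c / x^2"
    proof -
      have "metric_mu k \<Lambda> (\<lambda>r. a / 2 * (n (?t r) / S (?t r))) r = k - 2 * (a / 2 * q) / r - \<Lambda> * r^2 / 3"
        by (simp only: metric_mu_def t q_def)
      also have "\<dots> = k - q * x + c / x^2"
        using a pos unfolding c r_eq by (simp add: field_simps power2_eq_square)
      finally show ?thesis .
    qed
    have p: "p_theta N k (\<lambda>i. \<omega> i t) r = P t * x^4 / (4 * a^4)"
    proof -
      have "p_theta N k (\<lambda>i. \<omega> i t) r = 1 / (4 * r^4) * P t"
        by (simp only: p_theta_def t P)
      then show ?thesis using a pos unfolding r_eq by (simp add: power_divide)
    qed
    have dr: "a / r^2 = x^2 / a"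
      using a pos unfolding r_eq by (simp add: field_simps power2_eq_square)
    have G: "gauge_G N (\<lambda>i. dw i r) = H t * (x^4 / a^2)"
      unfolding gauge_G_def H dw_def t sum_distrib_right dr
      by (intro sum.cong) (simp_all add: power_mult_distrib power_divide)
    have W_eq: "r^2 * metric_mu k \<Lambda> (\<lambda>r. a / 2 * (n (?t r) / S (?t r))) r * ddw j r
            + (2 * (a / 2 * (n (?t r) / S (?t r))) - 2 * r^3 * p_theta N k (\<lambda>i. \<omega> i (?t r)) r
                 - 2 * \<Lambda> * r^3 / 3) * dw j r
            + gauge_W k (\<lambda>i. \<omega> i (?t r)) j * \<omega> j (?t r) = 0" if j: "j \<in> {1..N-1}" for j
    proof -
      have ddw: "ddw j r = x^4 / a^2 * (v' j t - 2 * v j t / x)"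
        unfolding ddw_def t dr using a pos unfolding r_eq by (simp add: field_simps power3_eq_cube power4_eq_xxxx power2_eq_square)
      \<comment> \<open>After inserting \<open>Y\<close> and \<open>Y'\<close> the \<open>H\<close>
        terms of \<open>S'\<close> and \<open>n'\<close> cancel, only the \<open>P\<close> term of
        \<open>n'\<close> remains, and \<open>S t\<close> becomes a common factor.\<close>
      have "S t * ((k * x^2 + c - x^3 * q) * v' j t
              + (3 * x^2 * q - 2 * k * x - x^3 * P t / (2 * a^2)) * v j t
              + gauge_W k (\<lambda>i. \<omega> i t) j * \<omega> j t) = 0"
        using gauge[OF j t(3,4)] a unfolding Y Y'_eq[OF t(3,4)] S'_def n'_def t(2) n_eq
        by (simp add: algebra_simps)
      then have "(k * x^2 + c - x^3 * q) * v' j t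
              + (3 * x^2 * q - 2 * k * x - x^3 * P t / (2 * a^2)) * v j t
              = - (gauge_W k (\<lambda>i. \<omega> i t) j * \<omega> j t)"
        using St by simp
      \<comment> \<open>The derivative terms of the gauge equation in r, rewritten by the chain
        rule, are those of the equation in t.\<close>
      moreover have "r^2 * (k - q * x + c / x^2) * (x^4 / a^2 * (v' j t - 2 * v j t / x))
            + (2 * (a / 2 * q) - 2 * r^3 * (P t * x^4 / (4 * a^4)) - 2 * \<Lambda> * r^3 / 3) * (v j t * (x^2 / a))
            = (k * x^2 + c - x^3 * q) * v' j t
              + (3 * x^2 * q - 2 * k * x - x^3 * P t / (2 * a^2)) * v j t"
        using a pos unfolding r_eq c
        by (simp add: field_simps power3_eq_cube power4_eq_xxxx power2_eq_square)
      ultimately show ?thesis unfolding mu p ddw dw_def t dr q_def[symmetric] by linarith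
    qed
    have "((\<lambda>r. \<omega> j (?t r)) has_real_derivative dw j r) (at r within {a..})" if "j \<in> {1..N-1}" for j
      using chain[OF \<omega>[OF that t(3,4)]] unfolding dw_def t
      by (rule has_field_derivative_at_within)
    moreover have "(dw j has_real_derivative ddw j r) (at r within {a..})" if "j \<in> {1..N-1}" for j
    proof (rule has_field_derivative_at_within)
      have "((\<lambda>r. a / r^2) has_real_derivative - 2 * a / r^3) (at r)"
        using pos by (auto intro!: derivative_eq_intros simp: power3_eq_cube power2_eq_square field_simps)
      from DERIV_mult[OF chain[OF v[OF that t(3,4)]] this]
      show "(dw j has_real_derivative ddw j r) (at r)"
        unfolding dw_def[abs_def] ddw_def t by (simp add: power2_eq_square algebra_simps)
    qed
    moreover have "((\<lambda>r. a / 2 * (n (?t r) / S (?t r))) has_real_derivative dm r) (at r within {a..})"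
    proof (rule has_field_derivative_at_within)
      have "((\<lambda>t. a / 2 * (n t / S t)) has_real_derivative a / 2 * ((n' t * S t - n t * S' t) / (S t)^2)) (at t)"
        using DERIV_cmult[OF DERIV_divide[OF n[OF t(3,4)] S[OF t(3,4)]], of "a / 2"] St
        by (simp add: n'_def S'_def power2_eq_square)
      from chain[OF this] show "((\<lambda>r. a / 2 * (n (?t r) / S (?t r))) has_real_derivative dm r) (at r)"
        unfolding dm_def t .
    qed
    moreover have "((\<lambda>r. S (?t r) / s) has_real_derivative dS r) (at r within {a..})"
    proof (rule has_field_derivative_at_within)
      show "((\<lambda>r. S (?t r) / s) has_real_derivative dS r) (at r)"
        using DERIV_cdivide[OF chain[OF S[OF t(3,4)]], of s] unfolding dS_def S'_def t .
    qed
    moreover have "dm r = (k - q * x + c / x^2) * (H t * (x^4 / a^2)) + r^2 * (P t * x^4 / (4 * a^4))"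
    proof -
      have "dm r = a / 2 * ((n' t * S t - n t * S' t) / (S t)^2) * (x^2 / a)"
        by (simp only: dm_def t dr)
      also have "\<dots> = (k - q * x + c / x^2) * (H t * (x^4 / a^2)) + r^2 * (P t * x^4 / (4 * a^4))"
        using a pos St unfolding n'_def S'_def t(2) n_eq r_eq
        by (simp add: field_simps power3_eq_cube power4_eq_xxxx power2_eq_square)
      finally show ?thesis .
    qed
    moreover have "dS r / (S t / s) = 2 * (H t * (x^4 / a^2)) / r"
    proof -
      have "dS r = S' t * (x^2 / a) / s"
        by (simp only: dS_def t dr)
      also have "S' t * (x^2 / a) / s / (S t / s) = 2 * (H t * (x^4 / a^2)) / r"
        using a pos St s unfolding S'_def t(2) r_eq
        by (simp add: field_simps power3_eq_cube power4_eq_xxxx power2_eq_square)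
      finally show ?thesis .
    qed
    ultimately show ?thesis using W_eq unfolding mu p G t by blast
  qed
  have "\<omega> 0 (?t r) = 0 \<and> \<omega> N (?t r) = 0 \<and> S (?t r) / s > 0" if "r \<in> {a..}" for r
    using zero S_pos[of "?t r"] s a that by simp
  then have alg: "\<forall>r\<in>{a..}. \<omega> 0 (?t r) = 0 \<and> \<omega> N (?t r) = 0 \<and> S (?t r) / s > 0" by blast
  show ?thesis
    unfolding sun_eym_solution_on_def
    by (rule conjI[OF alg], rule exI[of _ dm], rule exI[of _ dS], rule exI[of _ dw], rule exI[of _ ddw],
        rule ballI, rule main)
qed

text \<open>For |z - a| < a/2 one has |z| > a/2, hence |1 - a/z| = |z - a|/|z| < 1, so composing
  \<open>f\<close> with z -> 1 - a/z is holomorphic near a. At real points the powers are real, and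
  taking real parts of the coefficients gives the real series.\<close>

lemma has_regular_taylor_at_right_compactified:
  assumes f: "real_holo f" and a: "a > 0"
    and h: "\<And>r. r \<ge> a \<Longrightarrow> h r = Re (f (of_real (1 - a / r)))"
  shows "has_regular_taylor_at_right h a"
proof -
  define g where "g z = f (1 - of_real a / z)" for z
  have in_ball: "1 - of_real a / z \<in> dom_ball" "z \<noteq> 0" if z: "z \<in> ball (of_real a) (a / 2)" for z
  proof -
    have d: "norm (z - of_real a) < a / 2" using z by (simp add: dist_norm norm_minus_commute)
    have "norm (complex_of_real a) \<le> norm (z - of_real a) + norm z"
      using norm_triangle_ineq[of "of_real a - z" z] by (simp add: norm_minus_commute)
    then have nz: "norm z > a / 2" using d a by simp
    then show "z \<noteq> 0" using a by auto
    then have "1 - of_real a / z = (z - of_real a) / z" by (simp add: field_simps)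
    then have "norm (1 - of_real a / z) = norm (z - of_real a) / norm z" by (simp add: norm_divide)
    also have "\<dots> < 1" using d nz a by (simp add: divide_less_eq_1)
    finally show "1 - of_real a / z \<in> dom_ball" by (simp add: dom_ball_def)
  qed
  have "g holomorphic_on ball (of_real a) (a / 2)"
    unfolding g_def
    by (rule holomorphic_on_compose_gen[OF _ real_holo_D(1)[OF f], unfolded o_def])
       (use in_ball in \<open>auto intro!: holomorphic_intros\<close>)
  then have sums: "(\<lambda>n. (deriv ^^ n) g (of_real a) / fact n * (z - of_real a)^n) sums g z"
    if "z \<in> ball (of_real a) (a / 2)" for z
    using that by (rule holomorphic_power_series)
  have "(\<lambda>n. Re ((deriv ^^ n) g (of_real a) / fact n) * (r - a)^n) sums h r"
    if r: "r \<in> {a..<a + a / 2}" for r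
  proof -
    have "of_real r \<in> ball (complex_of_real a) (a / 2)"
      using r by (simp add: dist_norm flip: of_real_diff)
    from sums_Re[OF sums[OF this]]
    have "(\<lambda>n. Re ((deriv ^^ n) g (of_real a) / fact n * of_real ((r - a)^n))) sums Re (g (of_real r))"
      by simp
    moreover have "Re (w * of_real x) = Re w * x" for w x by simp
    moreover have "h r = Re (g (of_real r))" using h[of r] r by (simp add: g_def)
    ultimately show ?thesis by (simp only:)
  qed
  then show ?thesis
    unfolding has_regular_taylor_at_right_def using a
    by (intro exI[of _ "a / 2"] conjI exI[of _ "\<lambda>n. Re ((deriv ^^ n) g (of_real a) / fact n)"] ballI) simp_all
qed

text \<open>Since 1 - a/r differs from 1 by -a/r, dividing by 1/r yields -a times a difference
  quotient of \<open>f\<close> at 1, which converges.\<close>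

lemma compactified_limit_bigo:
  fixes f :: "real \<Rightarrow> real"
  assumes "(f has_real_derivative f') (at 1)" and a: "a > 0"
  shows "(\<lambda>r. f (1 - a / r) - f 1) \<in> O[at_top](\<lambda>r. 1 / r)"
proof (rule bigoI_tendsto)
  have "((\<lambda>y. (f y - f 1) / (y - 1)) \<longlongrightarrow> f') (at 1)"
    using assms(1) by (simp add: has_field_derivative_iff)
  moreover have "filterlim (\<lambda>r. 1 - a / r) (at 1) at_top"
    unfolding filterlim_at
  proof
    show "\<forall>\<^sub>F r in at_top. 1 - a / r \<in> UNIV \<and> 1 - a / r \<noteq> 1"
      using eventually_gt_at_top[of 0] by eventually_elim (use a in auto)
    show "((\<lambda>r. 1 - a / r) \<longlongrightarrow> 1) at_top" by real_asymp
  qed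
  ultimately have "((\<lambda>r. (f (1 - a / r) - f 1) / (1 - a / r - 1)) \<longlongrightarrow> f') at_top"
    by (rule filterlim_compose)
  then have "((\<lambda>r. - a * ((f (1 - a / r) - f 1) / (1 - a / r - 1))) \<longlongrightarrow> - a * f') at_top"
    by (intro tendsto_intros)
  then show "((\<lambda>r. (f (1 - a / r) - f 1) / (1 / r)) \<longlongrightarrow> - a * f') at_top"
    by (rule Lim_transform_eventually)
       (use eventually_gt_at_top[of 0] in eventually_elim, use a in \<open>simp add: field_simps\<close>)
  show "\<forall>\<^sub>F r in at_top. 1 / r \<noteq> (0 :: real)"
    using eventually_gt_at_top[of 0] by eventually_elim auto
qed

subsection \<open>The fixed point equation\<close>

locale eym_horizon =
  fixes k a :: real and N :: nat and wh :: "nat \<Rightarrow> real"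
  assumes a_pos: "a > 0" and N_pos: "N > 0"
begin

text \<open>
  With \<open>c = -\<Lambda> a\<^sup>2 / 3 = 1 / e\<^sup>2\<close> the unknowns are rescaled as \<open>S = 1 + e u\<^sub>0\<close> and
  \<open>d\<omega>\<^sub>j/dt = e u\<^sub>j\<close>. Primitives vanishing at the horizon are \<open>z \<cdot> avg f z\<close>, so the zero of
  \<open>Y = S \<mu> (1 - t)\<^sup>2 = c z \<eta>\<close> at the horizon cancels explicitly.
\<close>

definition H where
  "H u z = (\<Sum>j\<in>{1..N-1}. (u j z)^2)" for u :: "nat \<Rightarrow> complex \<Rightarrow> complex"

definition S :: "real \<Rightarrow> (nat \<Rightarrow> complex \<Rightarrow> complex) \<Rightarrow> complex \<Rightarrow> complex" where
  "S e u z = 1 + of_real e * u 0 z"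

text \<open>The default 0 encodes \<omega>_0 = \<omega>_N = 0; in particular \<open>u 0\<close>, the
  unknown belonging to \<open>S\<close>, never enters a gauge function.\<close>

definition om :: "nat \<Rightarrow> real \<Rightarrow> (nat \<Rightarrow> complex \<Rightarrow> complex) \<Rightarrow> complex \<Rightarrow> complex" where
  "om j e u z = (if j \<in> {1..N-1} then of_real (wh j) + of_real e * (z * avg (u j) z) else 0)"

definition W where
  "W j e u z = of_real k - om j e u z ^ 2 + of_real (1/2) * (om (j - 1) e u z ^ 2 + om (j + 1) e u z ^ 2)"

definition P where
  "P e u z = (\<Sum>j\<in>{1..N}. (om j e u z ^ 2 - om (j - 1) e u z ^ 2
                - of_real (k * (real N + 1 - 2 * real j)))^2)"

text \<open>This is e^2 (k (1 - z)^2 + c) with c = 1/e^2, which stays bounded as e tends to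
  0.\<close>

definition bg :: "real \<Rightarrow> complex \<Rightarrow> complex" where
  "bg e z = of_real k * of_real e ^ 2 * (1 - z)^2 + 1"

text \<open>Since d\<omega>_j/dt = e u_j, the true sum of squares is e^2 \<open>H\<close>. Hence
  dS/dt = e^2 \<open>S_rate\<close>; in dn/dt the factor e^2 is absorbed by \<open>bg\<close>, so
  dn/dt = \<open>n_rate\<close>.\<close>

definition S_rate where
  "S_rate e u z = of_real (2 / a^2) * (1 - z)^3 * H u z * S e u z"

definition n_rate where
  "n_rate e u z = S e u z * (of_real (2 / a^2) * bg e z * H u z + of_real (1 / (2 * a^2)) * P e u z)"

text \<open>The corrections to Y/c after division by z. They are of order e^2; one factor e is left
  outside, in \<open>eta\<close>, to make them visibly small.\<close>

definition eta_err where
  "eta_err e u z = of_real e * of_real k * (1 - z)^2 + of_real e * avg (S_rate e u) z * bg e z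
                     - of_real e * (1 - z)^3 * avg (n_rate e u) z"

definition eta where
  "eta e u z = (of_real 3 - of_real 3 * z + z^2) + of_real e * eta_err e u z"

definition source where
  "source j e u z = S e u z * W j e u z * om j e u z"

text \<open>The integrated equations divided by e. For j > 0, c z \<open>eta\<close> e u_j = - z
  \<open>avg\<close> (\<open>source\<close> j) with c = 1/e^2, and z cancels; the vanishing
  integration constant at the horizon selects the regular solution.\<close>

definition T where
  "T j e u = (if j = 0 then \<lambda>z. z * avg (S_rate e u) z
              else if j \<in> {1..N-1} then \<lambda>z. - (inverse (eta e u z) * avg (source j e u) z)
              else (\<lambda>z. 0))"

section \<open>Solvability for small e\<close>

lemma nice_H: "nice e\<^sub>0 (\<lambda>e. H)"
  unfolding H_def[abs_def] by (intro nice_intros)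

lemma nice_S: "nice e\<^sub>0 S"
  unfolding S_def[abs_def] by (intro nice_intros)

lemma nice_om: "nice e\<^sub>0 (om j)"
  unfolding om_def[abs_def] by (cases "j \<in> {1..N-1}"; simp only: if_True if_False) (intro nice_intros)+

lemma nice_W: "nice e\<^sub>0 (W j)"
  unfolding W_def[abs_def] by (intro nice_intros nice_om)

lemma nice_P: "nice e\<^sub>0 P"
  unfolding P_def[abs_def] by (intro nice_intros nice_om)

lemma nice_bg: "nice e\<^sub>0 (\<lambda>e u. bg e)"
  unfolding bg_def[abs_def] by (intro nice_intros)

lemma nice_S_rate: "nice e\<^sub>0 S_rate"
  unfolding S_rate_def[abs_def] by (intro nice_intros nice_H nice_S)

lemma nice_n_rate: "nice e\<^sub>0 n_rate"
  unfolding n_rate_def[abs_def] by (intro nice_intros nice_H nice_S nice_bg nice_P)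

lemma nice_eta_err: "nice e\<^sub>0 eta_err"
  unfolding eta_err_def[abs_def]
  by (intro nice_intros nice_avg[OF nice_S_rate] nice_avg[OF nice_n_rate] nice_bg)

lemma nice_eta: "nice e\<^sub>0 eta"
  unfolding eta_def[abs_def] by (intro nice_intros nice_eta_err)

lemma nice_source: "nice e\<^sub>0 (source j)"
  unfolding source_def[abs_def] by (intro nice_intros nice_S nice_W nice_om)

text \<open>The factorisation \<open>(3 - 3z + z\<^sup>2)(3 + 3z + z\<^sup>2) = 9 - 3z\<^sup>2 + z\<^sup>4\<close> makes the bound elementary.\<close>

lemma eta_main_lower:
  assumes "z \<in> dom_ball"
  shows "norm (of_real 3 - of_real 3 * z + z^2) \<ge> 1/5"
proof -
  have z: "norm z \<le> 5/4" using assms by (simp add: dom_ball_def)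
  have z2: "norm (z^2) \<le> 25/16" and z4: "norm (z^4) \<le> 625/256"
    using power_mono[OF z norm_ge_zero, of 2] power_mono[OF z norm_ge_zero, of 4]
    by (simp_all add: norm_power power_divide)
  have up: "norm (3 + 3 * z + z^2) \<le> 9"
    using norm_triangle_ineq[of "3 + 3 * z" "z^2"] norm_triangle_ineq[of 3 "3 * z"] z z2
    by (simp add: norm_mult)
  have "norm (9 :: complex) \<le> norm (9 - 3 * z^2 + z^4) + norm (3 * z^2) + norm (z^4)"
    using norm_triangle_ineq[of "9 - 3 * z^2 + z^4" "3 * z^2 - z^4"] norm_triangle_ineq4[of "3 * z^2" "z^4"]
    by simp
  \<comment> \<open>The left side is 479/256, which is just above 9/5.\<close>
  then have "9 - 3 * (25/16) - 625/256 \<le> norm (9 - 3 * z^2 + z^4)"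
    using z2 z4 by (simp add: norm_mult)
  also have "9 - 3 * z^2 + z^4 = (of_real 3 - of_real 3 * z + z^2) * (3 + 3 * z + z^2)"
    by (simp add: algebra_simps power2_eq_square power4_eq_xxxx)
  also have "norm \<dots> \<le> norm (of_real 3 - of_real 3 * z + z^2) * 9"
    unfolding norm_mult by (intro mult_left_mono up norm_ge_zero)
  finally show ?thesis by simp
qed

text \<open>\<open>T\<close> contains the inverse of \<open>eta\<close>, so the range of e is shrunk
  first: once the error is at most 1/10, \<open>eta\<close> has modulus at least 1/5 - 1/10. The
  error bound is passed on, since positivity of \<mu> rests on it too.\<close>

lemma exists_fixpoint:
  obtains e\<^sub>1 where "e\<^sub>1 > 0"
    "\<And>e. \<lbrakk>0 < e; e \<le> e\<^sub>1\<rbrakk> \<Longrightarrow> \<exists>u\<in>unit_family. (\<forall>j. \<forall>z\<in>dom_ball. of_real e * T j e u z = u j z)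
            \<and> (\<forall>z\<in>dom_ball. norm (of_real e * eta_err e u z) \<le> 1/10)"
proof -
  obtain C where C: "C \<ge> 0" "lip_functional 1 eta_err C"
    using nice_eta_err by (rule niceE)
  \<comment> \<open>Chosen so that both \<open>e\<^sub>0 \<le> 1\<close>, where \<open>C\<close> is
    valid, and \<open>e\<^sub>0 * C \<le> 1/10\<close> hold.\<close>
  define e\<^sub>0 where "e\<^sub>0 = 1 / (10 * C + 10)"
  have e0: "0 < e\<^sub>0" "e\<^sub>0 \<le> 1" "e\<^sub>0 * C \<le> 1/10" using C(1) by (auto simp: e\<^sub>0_def field_simps)
  have err: "norm (of_real e * eta_err e u z) \<le> 1/10"
    if "0 < e" "e \<le> e\<^sub>0" "u \<in> unit_family" "z \<in> dom_ball" for e u z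
  proof -
    have "norm (of_real e * eta_err e u z) \<le> e\<^sub>0 * C"
      using that e0 lip_functionalD(2)[OF C(2), of e u z] C(1)
      unfolding norm_mult by (intro mult_mono) auto
    then show ?thesis using e0(3) by linarith
  qed
  have nice_inv: "nice e\<^sub>0 (\<lambda>e u z. inverse (eta e u z))"
  proof (rule nice_inverse[OF nice_eta, of "1/10"])
    fix e and u :: "nat \<Rightarrow> complex \<Rightarrow> complex" and z assume *: "0 < e" "e \<le> e\<^sub>0" "u \<in> unit_family" "z \<in> dom_ball"
    have "norm (of_real 3 - of_real 3 * z + z^2) \<le> norm (eta e u z) + norm (of_real e * eta_err e u z)"
      unfolding eta_def using norm_triangle_ineq4 by (metis add_diff_cancel_right')
    then show "1/10 \<le> norm (eta e u z)"
      using eta_main_lower[OF *(4)] err[OF *] by linarith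
  qed simp
  have nice_T: "nice e\<^sub>0 (T j)" for j
  proof -
    have "nice e\<^sub>0 (\<lambda>e u z. z * avg (S_rate e u) z)"
      by (intro nice_mult nice_id nice_avg[OF nice_S_rate])
    moreover have "nice e\<^sub>0 (\<lambda>e u z. - (inverse (eta e u z) * avg (source j e u) z))"
      by (intro nice_uminus nice_mult nice_inv nice_avg[OF nice_source])
    ultimately show ?thesis
      unfolding T_def[abs_def]
      by (cases "j = 0"; cases "j \<in> {1..N-1}"; simp only: if_True if_False nice_0 simp_thms)
  qed
  show ?thesis
  proof (rule small_nice_fixpoint[of "{0..N-1}" e\<^sub>0 T])
    fix e\<^sub>1 assume e1: "0 < e\<^sub>1" "e\<^sub>1 \<le> e\<^sub>0"
      and fp: "\<And>e. \<lbrakk>0 < e; e \<le> e\<^sub>1\<rbrakk> \<Longrightarrow> \<exists>u\<in>unit_family. \<forall>i. \<forall>z\<in>dom_ball. of_real e * T i e u z = u i z"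
    show ?thesis
      by (rule that[OF e1(1)]) (use fp err e1 order_trans in meson)
  qed (use nice_T e0 in \<open>auto simp: T_def[abs_def]\<close>)
qed

end

subsection \<open>From the fixed point to the black hole\<close>

text \<open>\<open>e \<le> 1/2\<close> keeps \<open>S\<close> within 1/2 of 1, hence away from 0;
  \<open>away\<close> compares the horizon values with 5/4 e, the largest possible variation of a
  gauge function on the disc.\<close>

locale eym_fixpoint = eym_horizon +
  fixes e \<Lambda> c :: real and u :: "nat \<Rightarrow> complex \<Rightarrow> complex"
  assumes e: "0 < e" "e \<le> 1/2"
    and c: "c = 1 / e^2" "\<Lambda> = - 3 * c / a^2"
    and u: "u \<in> unit_family"
    and fixpoint: "\<And>j z. z \<in> dom_ball \<Longrightarrow> of_real e * T j e u z = u j z"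
    and err: "\<And>z. z \<in> dom_ball \<Longrightarrow> norm (of_real e * eta_err e u z) \<le> 1/10"
    and away: "\<And>j. j \<in> {1..N-1} \<Longrightarrow> 5/4 * e < \<bar>wh j\<bar>"
begin

lemma nice_real_holo:
  assumes "nice e \<Phi>"
  shows "real_holo (\<Phi> e u)"
  using assms lip_functionalD(1)[of e \<Phi> _ e u] e u unfolding nice_def by auto

lemmas real_holo_u = unit_familyD(1)[OF u]
  and real_holo_S = nice_real_holo[OF nice_S]
  and real_holo_om = nice_real_holo[OF nice_om]
  and real_holo_S_rate = nice_real_holo[OF nice_S_rate]
  and real_holo_n_rate = nice_real_holo[OF nice_n_rate]
  and real_holo_eta = nice_real_holo[OF nice_eta]
  and real_holo_source = nice_real_holo[OF nice_source]

text \<open>This is n/c = e^2 n. Its value 1 + k e^2 at 0 is the horizon condition 2m/a = k + c, as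
  S = 1 there.\<close>

definition nu :: "complex \<Rightarrow> complex" where
  "nu z = 1 + of_real k * of_real e ^ 2 + of_real e ^ 2 * (z * avg (n_rate e u) z)"

lemma real_holo_nu: "real_holo nu"
proof -
  have "nice e (\<lambda>e u z. 1 + of_real k * of_real e ^ 2 + of_real e ^ 2 * (z * avg (n_rate e u) z))"
    by (intro nice_intros nice_avg[OF nice_n_rate])
  from nice_real_holo[OF this] show ?thesis by (simp add: nu_def[abs_def])
qed

lemma S_eq: "z \<in> dom_ball \<Longrightarrow> S e u z = 1 + of_real e ^ 2 * (z * avg (S_rate e u) z)"
  using fixpoint[of z 0] unfolding S_def by (simp add: T_def power2_eq_square)

lemma S_ge: "z \<in> dom_ball \<Longrightarrow> norm (S e u z - 1) \<le> 1/2"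
  using mult_mono[OF e(2) unit_familyD(2)[OF u, of z 0]] e by (simp add: S_def norm_mult)

lemma S_nonzero: "z \<in> dom_ball \<Longrightarrow> S e u z \<noteq> 0"
  using S_ge[of z] by auto

lemma eta_nonzero: "z \<in> dom_ball \<Longrightarrow> eta e u z \<noteq> 0"
  using eta_main_lower[of z] err[of z]
    norm_triangle_ineq4[of "eta e u z" "of_real e * eta_err e u z"]
  by (auto simp: eta_def)

text \<open>The zero at the horizon factors out because 1 - (1 - z)^3 = z (3 - 3z + z^2), (1 - z)^2
  - (1 - z)^3 = z (1 - z)^2, and both primitives carry a factor z.\<close>

lemma Y_eq:
  assumes "z \<in> dom_ball"
  shows "S e u z * bg e z - (1 - z)^3 * nu z = z * eta e u z"
  unfolding S_eq[OF assms] nu_def eta_def eta_err_def bg_def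
  by (simp add: algebra_simps power2_eq_square power3_eq_cube)

lemma source_eq:
  assumes "j \<in> {1..N-1}" "z \<in> dom_ball"
  shows "(z * eta e u z) * u j z = - (of_real e * (z * avg (source j e u) z))"
proof -
  have "u j z = - (of_real e * (inverse (eta e u z) * avg (source j e u) z))"
    using fixpoint[OF assms(2), of j] assms(1) by (simp add: T_def)
  then show ?thesis using eta_nonzero[OF assms(2)] by (simp add: field_simps)
qed

lemma dS: "z \<in> dom_ball \<Longrightarrow> (S e u has_field_derivative of_real e ^ 2 * S_rate e u z) (at z)"
  by (rule has_field_derivative_transform_within_open
        [of "\<lambda>z. 1 + of_real e ^ 2 * (z * avg (S_rate e u) z)" _ _ dom_ball])
     (use S_eq in \<open>auto intro!: avg_deriv_affine real_holo_D(1)[OF real_holo_S_rate]\<close>)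

lemma dnu: "z \<in> dom_ball \<Longrightarrow> (nu has_field_derivative of_real e ^ 2 * n_rate e u z) (at z)"
  unfolding nu_def[abs_def]
  by (intro avg_deriv_affine real_holo_D(1)[OF real_holo_n_rate])

lemma d_om:
  assumes "j \<in> {1..N-1}" "z \<in> dom_ball"
  shows "(om j e u has_field_derivative of_real e * u j z) (at z)"
proof -
  have "((\<lambda>z. of_real (wh j) + of_real e * (z * avg (u j) z)) has_field_derivative of_real e * u j z) (at z)"
    using assms(2) by (intro avg_deriv_affine real_holo_D(1)[OF real_holo_u])
  then show ?thesis using assms(1) by (simp add: om_def[abs_def])
qed

lemma du: "z \<in> dom_ball \<Longrightarrow> (u j has_field_derivative deriv (u j) z) (at z)"
  by (rule holomorphic_derivI[OF real_holo_D(1)[OF real_holo_u]]) auto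

lemma dY: "z \<in> dom_ball \<Longrightarrow>
  ((\<lambda>z. z * eta e u z) has_field_derivative deriv (\<lambda>z. z * eta e u z) z) (at z)"
  by (rule holomorphic_derivI[of _ dom_ball])
     (auto intro!: holomorphic_intros real_holo_D(1)[OF real_holo_eta])

text \<open>The product \<open>z * eta e u z * u j z\<close> is differentiated twice: by the product
  rule, and as the primitive provided by \<open>source_eq\<close>.\<close>

lemma gauge:
  assumes j: "j \<in> {1..N-1}" and z: "z \<in> dom_ball"
  shows "(z * eta e u z) * deriv (u j) z + deriv (\<lambda>z. z * eta e u z) z * u j z
           = - (of_real e * source j e u z)"
proof (rule DERIV_unique)
  show "((\<lambda>z. (z * eta e u z) * u j z) has_field_derivative
          (z * eta e u z) * deriv (u j) z + deriv (\<lambda>z. z * eta e u z) z * u j z) (at z)"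
    using DERIV_mult[OF dY[OF z] du[OF z, of j]] by (simp add: mult.commute add.commute)
  have "((\<lambda>z. - (of_real e * (z * avg (source j e u) z))) has_field_derivative
          - (of_real e * source j e u z)) (at z)"
    using avg_deriv_affine[OF real_holo_D(1)[OF real_holo_source[of j]] z, of 0 "- of_real e"] by simp
  then show "((\<lambda>z. (z * eta e u z) * u j z) has_field_derivative - (of_real e * source j e u z)) (at z)"
    by (rule has_field_derivative_transform_within_open[of _ _ _ dom_ball])
       (use z j source_eq in auto)
qed

section \<open>Restriction to the real axis\<close>

definition rS where "rS t = Re (S e u (of_real t))"
definition rn where "rn t = c * Re (nu (of_real t))"
definition rom where "rom j t = Re (om j e u (of_real t))"
definition rv where "rv j t = e * Re (u j (of_real t))"
definition rY where "rY t = rS t * (k * (1 - t)^2 + c) - (1 - t)^3 * rn t"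

lemma complex_of_r:
  assumes "\<bar>t\<bar> < 5/4"
  shows "S e u (of_real t) = of_real (rS t)"
    and "nu (of_real t) = of_real (e^2 * rn t)"
    and "om j e u (of_real t) = of_real (rom j t)"
    and "u j (of_real t) = of_real (rv j t / e)"
  using real_holo_Re[OF real_holo_S assms] real_holo_Re[OF real_holo_nu assms]
    real_holo_Re[OF real_holo_om assms, of j] real_holo_Re[OF real_holo_u assms, of j] e
  unfolding rS_def rn_def rom_def rv_def by (simp_all add: c)

lemma rS_ge: "\<bar>t\<bar> < 5/4 \<Longrightarrow> rS t \<ge> 1/2"
  using S_ge[of "of_real t"] abs_Re_le_cmod[of "S e u (of_real t) - 1"] by (simp add: rS_def)

lemma rY_eq:
  assumes "\<bar>t\<bar> < 5/4"
  shows "rY t = c * (t * Re (eta e u (of_real t)))"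
proof -
  have "complex_of_real (e^2 * rY t) = of_real t * eta e u (of_real t)"
    using e unfolding Y_eq[symmetric, of "of_real t", unfolded of_real_in_dom_ball, OF assms]
      bg_def complex_of_r[OF assms] rY_def
    by (simp add: c field_simps)
  also have "\<dots> = of_real (t * Re (eta e u (of_real t)))"
    using real_holo_Re[OF real_holo_eta assms] by simp
  finally have "e^2 * rY t = t * Re (eta e u (of_real t))"
    by (simp only: of_real_eq_iff)
  then show ?thesis using e by (simp add: c field_simps)
qed

text \<open>On [0, 1] the leading part 3 - 3t + t^2 = 1 + (1 - t)(2 - t) is at least 1, while the
  error is at most 1/10.\<close>

lemma Re_eta_pos:
  assumes "0 \<le> t" "t \<le> 1"
  shows "Re (eta e u (of_real t)) > 0"
proof -
  have "\<bar>Re (of_real e * eta_err e u (of_real t))\<bar> \<le> 1/10"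
    by (rule order_trans[OF abs_Re_le_cmod err]) (use assms in simp)
  moreover have "Re (of_real 3 - of_real 3 * of_real t + (of_real t)^2 :: complex) = 1 + (1 - t) * (2 - t)"
    by (simp add: power2_eq_square algebra_simps)
  moreover have "(1 - t) * (2 - t) \<ge> 0" using assms by simp
  ultimately show ?thesis unfolding eta_def plus_complex.sel by linarith
qed

text \<open>The range of t has the horizon t = 0 and infinity t = 1 in its interior, so two-sided
  derivatives are available at both.\<close>

lemma real_derivs:
  assumes t: "\<bar>t\<bar> < 5/4"
  shows "(rS has_real_derivative rS t * (2 / a^2 * (1 - t)^3 * gauge_G N (\<lambda>j. rv j t))) (at t)"
    and "(rn has_real_derivative
            rS t * (2 / a^2 * (k * (1 - t)^2 + c) * gauge_G N (\<lambda>j. rv j t)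
                    + (\<Sum>j\<in>{1..N}. ((rom j t)^2 - (rom (j - 1) t)^2 - k * (real N + 1 - 2 * real j))^2)
                      / (2 * a^2))) (at t)"
    and "j \<in> {1..N-1} \<Longrightarrow> (rom j has_real_derivative rv j t) (at t)"
    and "(rv j has_real_derivative e * Re (deriv (u j) (of_real t))) (at t)"
    and "(rY has_real_derivative c * Re (deriv (\<lambda>z. z * eta e u z) (of_real t))) (at t)"
proof -
  have t': "of_real t \<in> dom_ball" using t by simp
  \<comment> \<open>The denominator comes from \<open>rv j t\<close> = e u_j and cancels the
    prefactor e^2 of the rates.\<close>
  have H: "H u (of_real t) = of_real (gauge_G N (\<lambda>j. rv j t) / e^2)"
    unfolding H_def gauge_G_def complex_of_r[OF t]
    by (simp add: sum_divide_distrib power_divide)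
  have P: "P e u (of_real t) = of_real (\<Sum>j\<in>{1..N}. ((rom j t)^2 - (rom (j - 1) t)^2 - k * (real N + 1 - 2 * real j))^2)"
    unfolding P_def complex_of_r[OF t] by simp
  have "complex_of_real e ^ 2 * S_rate e u (of_real t)
          = of_real (rS t * (2 / a^2 * (1 - t)^3 * gauge_G N (\<lambda>j. rv j t)))"
    unfolding S_rate_def H complex_of_r[OF t] using e by (simp add: field_simps)
  with real_holo_deriv_Re[OF dS[OF t']]
  show "(rS has_real_derivative rS t * (2 / a^2 * (1 - t)^3 * gauge_G N (\<lambda>j. rv j t))) (at t)"
    unfolding rS_def[abs_def] by (simp only: Re_complex_of_real)
  have "complex_of_real e ^ 2 * n_rate e u (of_real t)
          = of_real (e^2 * (rS t * (2 / a^2 * (k * (1 - t)^2 + c) * gauge_G N (\<lambda>j. rv j t)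
                    + (\<Sum>j\<in>{1..N}. ((rom j t)^2 - (rom (j - 1) t)^2 - k * (real N + 1 - 2 * real j))^2)
                      / (2 * a^2))))"
    unfolding n_rate_def H P complex_of_r[OF t] bg_def using e a_pos by (simp add: c field_simps)
  with real_holo_deriv_Re[OF dnu[OF t']]
  have "((\<lambda>t. Re (nu (of_real t))) has_real_derivative
          e^2 * (rS t * (2 / a^2 * (k * (1 - t)^2 + c) * gauge_G N (\<lambda>j. rv j t)
                    + (\<Sum>j\<in>{1..N}. ((rom j t)^2 - (rom (j - 1) t)^2 - k * (real N + 1 - 2 * real j))^2)
                      / (2 * a^2)))) (at t)"
    by (simp only: Re_complex_of_real)
  from DERIV_cmult[OF this, of c] show "(rn has_real_derivative
            rS t * (2 / a^2 * (k * (1 - t)^2 + c) * gauge_G N (\<lambda>j. rv j t)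
                    + (\<Sum>j\<in>{1..N}. ((rom j t)^2 - (rom (j - 1) t)^2 - k * (real N + 1 - 2 * real j))^2)
                      / (2 * a^2))) (at t)"
    unfolding rn_def[abs_def] using e by (simp add: c)
  show "(rom j has_real_derivative rv j t) (at t)" if "j \<in> {1..N-1}"
    using real_holo_deriv_Re[OF d_om[OF that t']] unfolding rom_def[abs_def] rv_def by simp
  show "(rv j has_real_derivative e * Re (deriv (u j) (of_real t))) (at t)"
    using DERIV_cmult[OF real_holo_deriv_Re[OF du[OF t']]] unfolding rv_def[abs_def] .
  have "((\<lambda>t. c * Re (of_real t * eta e u (of_real t))) has_real_derivative
          c * Re (deriv (\<lambda>z. z * eta e u z) (of_real t))) (at t)"
    by (rule DERIV_cmult[OF real_holo_deriv_Re[OF dY[OF t']]])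
  then show "(rY has_real_derivative c * Re (deriv (\<lambda>z. z * eta e u z) (of_real t))) (at t)"
    by (rule has_field_derivative_transform_within_open[of _ _ _ "{-5/4<..<5/4}"])
       (use t in \<open>auto simp: rY_eq\<close>)
qed

lemma real_gauge:
  assumes j: "j \<in> {1..N-1}" and t: "\<bar>t\<bar> < 5/4"
  shows "rY t * (e * Re (deriv (u j) (of_real t))) + c * Re (deriv (\<lambda>z. z * eta e u z) (of_real t)) * rv j t
           = - (rS t * gauge_W k (\<lambda>i. rom i t) j * rom j t)"
proof -
  have t': "of_real t \<in> dom_ball" using t by simp
  have W: "W j e u (of_real t) = of_real (gauge_W k (\<lambda>i. rom i t) j)"
    unfolding W_def gauge_W_def complex_of_r[OF t] by simp
  \<comment> \<open>Naming the real factors lets the real part of each product split.\<close>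
  define y v where "y = t * Re (eta e u (of_real t))" and "v = rv j t / e"
  have "of_real t * eta e u (of_real t) = of_real y"
    using real_holo_Re[OF real_holo_eta t] by (simp add: y_def)
  with gauge[OF j t'] have "of_real y * deriv (u j) (of_real t)
      + deriv (\<lambda>z. z * eta e u z) (of_real t) * of_real v
     = of_real (- (e * (rS t * gauge_W k (\<lambda>i. rom i t) j * rom j t)))"
    unfolding source_def W complex_of_r[OF t] v_def by simp
  from arg_cong[OF this, of Re]
  have "y * Re (deriv (u j) (of_real t)) + v * Re (deriv (\<lambda>z. z * eta e u z) (of_real t))
     = - (e * (rS t * gauge_W k (\<lambda>i. rom i t) j * rom j t))"
    by (simp only: plus_complex.sel times_complex.sel Re_complex_of_real Im_complex_of_real)
       (simp add: mult.commute)
  \<comment> \<open>The multiplier is chosen because c e^2 = 1 removes the e on the right.\<close>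
  then have "c * e * (y * Re (deriv (u j) (of_real t))
      + v * Re (deriv (\<lambda>z. z * eta e u z) (of_real t)))
     = - (rS t * gauge_W k (\<lambda>i. rom i t) j * rom j t)"
    using e by (simp add: c power2_eq_square)
  then show ?thesis unfolding rY_eq[OF t] y_def[symmetric] using e by (simp add: v_def algebra_simps)
qed

text \<open>The deviation is e t \<open>avg (u j)\<close>, with |t| < 5/4 and the average at most 1
  in modulus. Together with \<open>away\<close> this excludes zeroes.\<close>

lemma rom_close:
  assumes "j \<in> {1..N-1}" "\<bar>t\<bar> < 5/4"
  shows "\<bar>rom j t - wh j\<bar> \<le> 5/4 * e"
proof -
  have t: "of_real t \<in> dom_ball" using assms by simp
  have "norm (avg (u j) (of_real t)) \<le> 1"
    by (rule avg_bound[OF real_holo_D(1)[OF real_holo_u] unit_familyD(2)[OF u] t])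
  then have "e * (\<bar>t\<bar> * norm (avg (u j) (of_real t))) \<le> e * (5/4 * 1)"
    using e assms(2) by (intro mult_left_mono mult_mono) auto
  then have "norm (om j e u (of_real t) - of_real (wh j)) \<le> 5/4 * e"
    using assms(1) e by (simp add: om_def norm_mult)
  then show ?thesis unfolding complex_of_r[OF assms(2)]
    by (simp flip: of_real_diff)
qed

lemma rom_nonzero: "j \<in> {1..N-1} \<Longrightarrow> \<bar>t\<bar> < 5/4 \<Longrightarrow> rom j t \<noteq> 0"
  using rom_close[of j t] away[of j] by force

section \<open>The black hole in the radial coordinate\<close>

definition bh_m where "bh_m r = a / 2 * (rn (1 - a / r) / rS (1 - a / r))"
text \<open>The fixed point has S = 1 at the horizon. Dividing by the value at t = 1 normalises S at
  infinity and leaves S'/S, the only way S enters the equations, unchanged.\<close>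

definition bh_S where "bh_S r = rS (1 - a / r) / rS 1"
definition bh_om where "bh_om j r = rom j (1 - a / r)"

lemma t_range: "r \<ge> a \<Longrightarrow> 0 \<le> 1 - a / r \<and> 1 - a / r < 1"
  using a_pos by simp

lemma t_abs: "r \<ge> a \<Longrightarrow> \<bar>1 - a / r\<bar> < 5/4"
  using t_range[of r] unfolding abs_less_iff by linarith

lemma c_pos: "c > 0"
  using e by (simp add: c)

lemma metric_mu_eq:
  assumes "r \<ge> a"
  shows "metric_mu k \<Lambda> bh_m r = rY (1 - a / r) / (rS (1 - a / r) * (1 - (1 - a / r))^2)"
proof -
  define t where "t = 1 - a / r"
  have r: "r = a / (1 - t)" and t: "t < 1" "0 \<le> t" using a_pos assms by (auto simp: t_def)
  have "rS t > 0" using rS_ge[of t] t by simp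
  have "metric_mu k \<Lambda> bh_m r = k - 2 * (a / 2 * (rn t / rS t)) / r - \<Lambda> * r^2 / 3"
    by (simp only: metric_mu_def bh_m_def t_def)
  also have "\<dots> = k - (rn t / rS t) * (1 - t) + c / (1 - t)^2"
    using a_pos t \<open>rS t > 0\<close> unfolding r c(2) by (simp add: field_simps)
  also have "\<dots> = rY t / (rS t * (1 - t)^2)"
  proof -
    have "k - n / s * x + c / x^2 = (s * (k * x^2 + c) - x^3 * n) / (s * x^2)" if "s > 0" "x > 0" for n s x
      using that by (simp add: field_simps power2_eq_square power3_eq_cube)
    then show ?thesis unfolding rY_def using \<open>rS t > 0\<close> t by simp
  qed
  finally show ?thesis by (simp only: t_def)
qed

lemma rY_pos: "0 < t \<Longrightarrow> t \<le> 1 \<Longrightarrow> rY t > 0"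
  using Re_eta_pos[of t] c_pos by (simp add: rY_eq)

text \<open>As \<open>rY\<close> vanishes at t = 0, only its own derivative c \<open>eta\<close>
  contributes to that of the quotient there; 1/a is dt/dr at the horizon.\<close>

lemma metric_mu_deriv:
  "(metric_mu k \<Lambda> bh_m has_real_derivative c * Re (eta e u 0) / a) (at a within {a..})"
proof -
  let ?q = "\<lambda>t. rY t / (rS t * (1 - t)^2)"
  have 0: "rY 0 = 0" "rS 0 = 1" by (simp_all add: rY_eq) (simp add: rS_def S_eq dom_ball_def)
  have "deriv (\<lambda>z. z * eta e u z) 0 = eta e u 0"
  proof (rule DERIV_imp_deriv)
    have "(eta e u has_field_derivative deriv (eta e u) 0) (at 0)"
      by (rule holomorphic_derivI[OF real_holo_D(1)[OF real_holo_eta]]) (auto simp: dom_ball_def)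
    from DERIV_mult[OF DERIV_ident this]
    show "((\<lambda>z. z * eta e u z) has_field_derivative eta e u 0) (at 0)" by simp
  qed
  then have "(rY has_real_derivative c * Re (eta e u 0)) (at 0)"
    using real_derivs(5)[of 0] by simp
  moreover obtain d where "(rS has_real_derivative d) (at 0)"
    using real_derivs(1)[of 0] by auto
  ultimately have "(?q has_real_derivative c * Re (eta e u 0)) (at (1 - a / a))"
    using a_pos 0 by (auto intro!: derivative_eq_intros)
  moreover have "((\<lambda>r. 1 - a / r) has_real_derivative 1 / a) (at a)"
    using a_pos by (auto intro!: derivative_eq_intros simp: field_simps power2_eq_square)
  ultimately have "((\<lambda>r. ?q (1 - a / r)) has_real_derivative c * Re (eta e u 0) * (1 / a)) (at a)"
    by (rule DERIV_chain2)
  then have "((\<lambda>r. ?q (1 - a / r)) has_real_derivative c * Re (eta e u 0) / a) (at a within {a..})"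
    by (simp add: has_field_derivative_at_within)
  then show ?thesis
    by (rule has_field_derivative_transform_within[of _ _ _ _ 1]) (auto simp: metric_mu_eq)
qed

lemma taylor_bh:
  "has_regular_taylor_at_right bh_m a"
  "has_regular_taylor_at_right bh_S a"
  "has_regular_taylor_at_right (bh_om j) a"
proof -
  have "real_holo (\<lambda>z. of_real (a / 2) * (of_real c * nu z / S e u z))"
    by (intro real_holo_mult real_holo_divide real_holo_const real_holo_nu real_holo_S S_nonzero)
  then show "has_regular_taylor_at_right bh_m a"
  proof (rule has_regular_taylor_at_right_compactified[OF _ a_pos])
    fix r assume "r \<ge> a"
    have ce: "c * e^2 = 1" using e by (simp add: c)
    have "of_real (a / 2) * (of_real c * nu (of_real (1 - a / r)) / S e u (of_real (1 - a / r)))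
            = of_real (a / 2 * ((c * e^2) * rn (1 - a / r) / rS (1 - a / r)))"
      unfolding complex_of_r[OF t_abs[OF \<open>r \<ge> a\<close>]] by simp
    then show "bh_m r = Re (of_real (a / 2) * (of_real c * nu (of_real (1 - a / r)) / S e u (of_real (1 - a / r))))"
      unfolding ce bh_m_def by (simp only: Re_complex_of_real mult_1)
  qed
  have "real_holo (\<lambda>z. S e u z * of_real (1 / rS 1))"
    by (intro real_holo_mult real_holo_const real_holo_S)
  then show "has_regular_taylor_at_right bh_S a"
    by (rule has_regular_taylor_at_right_compactified[OF _ a_pos])
       (simp add: bh_S_def rS_def)
  show "has_regular_taylor_at_right (bh_om j) a"
    by (rule has_regular_taylor_at_right_compactified[OF real_holo_om[of j] a_pos])
       (simp add: bh_om_def rom_def)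
qed

lemma black_hole: "black_hole_solution N k \<Lambda> a bh_m bh_S bh_om"
  unfolding black_hole_solution_def
proof (intro conjI ballI allI impI)
  have S1: "rS 1 > 0" using rS_ge[of 1] by simp
  have om0: "rom 0 t = 0" "rom N t = 0" for t
    using N_pos by (auto simp: rom_def om_def)
  show "sun_eym_solution_on {a..} N k \<Lambda> bh_m bh_S bh_om"
    unfolding bh_m_def[abs_def] bh_S_def[abs_def] bh_om_def[abs_def]
  proof (rule compactified_solution[where v = rv and v' = "\<lambda>j t. e * Re (deriv (u j) (of_real t))"
          and Y' = "\<lambda>t. c * Re (deriv (\<lambda>z. z * eta e u z) (of_real t))",
          OF a_pos S1 c(2) refl refl])
    fix t :: real assume t: "0 \<le> t" "t < 1"
    then have t': "\<bar>t\<bar> < 5/4" by simp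
    show "rS t > 0" using rS_ge[OF t'] by simp
    show "(rS has_real_derivative rS t * (2 / a^2 * (1 - t)^3 * gauge_G N (\<lambda>j. rv j t))) (at t)"
      by (rule real_derivs(1)[OF t'])
    show "(rn has_real_derivative
            rS t * (2 / a^2 * (k * (1 - t)^2 + c) * gauge_G N (\<lambda>j. rv j t)
                    + (\<Sum>j\<in>{1..N}. ((rom j t)^2 - (rom (j - 1) t)^2 - k * (real N + 1 - 2 * real j))^2)
                      / (2 * a^2))) (at t)"
      by (rule real_derivs(2)[OF t'])
    show "(rY has_real_derivative c * Re (deriv (\<lambda>z. z * eta e u z) (of_real t))) (at t)"
      by (rule real_derivs(5)[OF t'])
  next
    fix j and t :: real assume j: "j \<in> {1..N-1}" and t: "0 \<le> t" "t < 1"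
    then have t': "\<bar>t\<bar> < 5/4" by simp
    show "(rom j has_real_derivative rv j t) (at t)"
      by (rule real_derivs(3)[OF t' j])
    show "(rv j has_real_derivative e * Re (deriv (u j) (of_real t))) (at t)"
      by (rule real_derivs(4)[OF t'])
    show "rY t * (e * Re (deriv (u j) (of_real t))) + c * Re (deriv (\<lambda>z. z * eta e u z) (of_real t)) * rv j t
           = - (rS t * gauge_W k (\<lambda>i. rom i t) j * rom j t)"
      by (rule real_gauge[OF j t'])
  qed (use om0 rY_def in auto)
  show "metric_mu k \<Lambda> bh_m a = 0"
    using a_pos by (simp add: metric_mu_eq rY_eq)
  show "\<exists>d>0. (metric_mu k \<Lambda> bh_m has_real_derivative d) (at a within {a..})"
    using metric_mu_deriv Re_eta_pos[of 0] c_pos a_pos by (auto intro!: exI[of _ "c * Re (eta e u 0) / a"])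
  show "metric_mu k \<Lambda> bh_m r > 0" if "r > a" for r
  proof -
    have "rY (1 - a / r) > 0" using that a_pos by (intro rY_pos) auto
    moreover have "rS (1 - a / r) > 0" using rS_ge[OF t_abs, OF less_imp_le[OF that]] by linarith
    moreover have "1 - (1 - a / r) > 0" using that a_pos by simp
    ultimately show ?thesis using that
      by (simp only: metric_mu_eq less_imp_le divide_pos_pos mult_pos_pos zero_less_power)
  qed
  \<comment> \<open>Differentiability at t = 1 yields the decay rates at infinity.\<close>
  obtain d d' where d: "(rS has_real_derivative d) (at 1)" "(rn has_real_derivative d') (at 1)"
    using real_derivs(1,2)[of 1] by auto
  have "((\<lambda>t. a / 2 * (rn t / rS t)) has_real_derivative a / 2 * ((d' * rS 1 - rn 1 * d) / (rS 1 * rS 1))) (at 1)"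
    using S1 by (intro DERIV_cmult DERIV_divide d) simp
  from compactified_limit_bigo[OF this a_pos]
  show "\<exists>M. (\<lambda>r. bh_m r - M) \<in> O[at_top](\<lambda>r. 1 / r)"
    unfolding bh_m_def[abs_def] by blast
  from compactified_limit_bigo[OF DERIV_cdivide[OF d(1)] a_pos, of "rS 1"]
  show "(\<lambda>r. bh_S r - 1) \<in> O[at_top](\<lambda>r. 1 / r)"
    unfolding bh_S_def[abs_def] using S1 by simp
  show "\<exists>w. (\<lambda>r. bh_om j r - w) \<in> O[at_top](\<lambda>r. 1 / r)" if j: "j \<in> {1..N-1}" for j
    using compactified_limit_bigo[OF real_derivs(3)[OF _ j, of 1] a_pos]
    unfolding bh_om_def[abs_def] by auto
qed (use a_pos taylor_bh in auto)

lemma bh_om_horizon: "j \<in> {1..N-1} \<Longrightarrow> bh_om j a = wh j"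
  using a_pos by (simp add: bh_om_def rom_def om_def)

lemma bh_om_nonzero: "j \<in> {1..N-1} \<Longrightarrow> r \<ge> a \<Longrightarrow> bh_om j r \<noteq> 0"
  unfolding bh_om_def by (intro rom_nonzero t_abs)

end

section \<open>Threshold for the cosmological constant\<close>

theorem theorem6:
  fixes k r\<^sub>h :: real and N :: nat and \<omega>\<^sub>h :: "nat \<Rightarrow> real"
  assumes "k \<in> {-1, 0, 1}" and "N \<ge> 2" and "r\<^sub>h > 0"
    and "\<forall>j\<in>{1..N-1}. \<omega>\<^sub>h j \<noteq> 0"
  shows "\<exists>L>0. \<forall>\<Lambda> < - L. \<exists>m S \<omega>.
           black_hole_solution N k \<Lambda> r\<^sub>h m S \<omega> \<and>
           (\<forall>j\<in>{1..N-1}. \<omega> j r\<^sub>h = \<omega>\<^sub>h j) \<and>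
           (\<forall>j\<in>{1..N-1}. \<forall>r\<ge>r\<^sub>h. \<omega> j r \<noteq> 0)"
proof -
  interpret eym_horizon k r\<^sub>h N \<omega>\<^sub>h
    using assms by unfold_locales auto
  obtain e\<^sub>1 where e1: "e\<^sub>1 > 0"
    "\<And>e. \<lbrakk>0 < e; e \<le> e\<^sub>1\<rbrakk> \<Longrightarrow> \<exists>u\<in>unit_family. (\<forall>j. \<forall>z\<in>dom_ball. of_real e * T j e u z = u j z)
            \<and> (\<forall>z\<in>dom_ball. norm (of_real e * eta_err e u z) \<le> 1/10)"
    by (rule exists_fixpoint) blast
  define d where "d = Min ((\<lambda>j. \<bar>\<omega>\<^sub>h j\<bar>) ` {1..N-1})"
  have ne: "(\<lambda>j. \<bar>\<omega>\<^sub>h j\<bar>) ` {1..N-1} \<noteq> {}" using assms(2) by auto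
  have "d > 0" unfolding d_def using assms(4) ne by (subst Min_gr_iff) auto
  have d_le: "d \<le> \<bar>\<omega>\<^sub>h j\<bar>" if "j \<in> {1..N-1}" for j
    unfolding d_def using that by (intro Min_le) auto
  \<comment> \<open>The three bounds provide the fixed point, S near 1, and, through 5/4 e < d, the
    absence of zeroes.\<close>
  define e\<^sub>0 where "e\<^sub>0 = min e\<^sub>1 (min (1/2) (d / 2))"
  have "e\<^sub>0 > 0" using e1(1) \<open>d > 0\<close> by (simp add: e\<^sub>0_def)
  \<comment> \<open>Solves L r_h^2/3 = 1/e_0^2, so that \<Lambda> < -L gives c > 1/e_0^2, that is e
    = 1/sqrt c < e_0.\<close>
  define L where "L = 3 / (r\<^sub>h^2 * e\<^sub>0^2)"
  show ?thesis
  proof (intro exI[of _ L] conjI allI impI)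
    show "L > 0" using \<open>e\<^sub>0 > 0\<close> assms(3) by (simp add: L_def)
    fix \<Lambda> :: real assume "\<Lambda> < - L"
    define c where "c = - \<Lambda> * r\<^sub>h^2 / 3"
    define e where "e = 1 / sqrt c"
    have "L * r\<^sub>h^2 / 3 < c"
      unfolding c_def using \<open>\<Lambda> < - L\<close> assms(3) by (intro divide_strict_right_mono mult_strict_right_mono) auto
    then have c: "c > 1 / e\<^sub>0^2" using assms(3) by (simp add: L_def)
    moreover have "1 / e\<^sub>0^2 > 0" using \<open>e\<^sub>0 > 0\<close> by simp
    ultimately have c_pos: "c > 0" by linarith
    then have "e > 0" by (simp add: e_def)
    have "1 / e\<^sub>0 < sqrt c"
      using c \<open>e\<^sub>0 > 0\<close> by (intro real_less_rsqrt) (simp add: power_divide)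
    then have "e < e\<^sub>0" unfolding e_def using \<open>e\<^sub>0 > 0\<close> c_pos by (simp add: field_simps)
    then have e: "e \<le> e\<^sub>1" "e \<le> 1/2" "5/4 * e < d"
      using \<open>e > 0\<close> by (auto simp: e\<^sub>0_def)
    obtain u where u: "u \<in> unit_family" "\<forall>j. \<forall>z\<in>dom_ball. of_real e * T j e u z = u j z"
      "\<forall>z\<in>dom_ball. norm (of_real e * eta_err e u z) \<le> 1/10"
      using e1(2)[OF \<open>e > 0\<close> e(1)] by blast
    interpret eym_fixpoint k r\<^sub>h N \<omega>\<^sub>h e \<Lambda> c u
    proof
      show "c = 1 / e^2" using c_pos by (simp add: e_def power_divide)
      show "\<Lambda> = - 3 * c / r\<^sub>h^2" using assms(3) by (simp add: c_def)
      show "5/4 * e < \<bar>\<omega>\<^sub>h j\<bar>" if "j \<in> {1..N-1}" for j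
        using e(3) d_le[OF that] by linarith
    qed (use u e \<open>e > 0\<close> in blast)+
    show "\<exists>m S \<omega>. black_hole_solution N k \<Lambda> r\<^sub>h m S \<omega> \<and>
           (\<forall>j\<in>{1..N-1}. \<omega> j r\<^sub>h = \<omega>\<^sub>h j) \<and>
           (\<forall>j\<in>{1..N-1}. \<forall>r\<ge>r\<^sub>h. \<omega> j r \<noteq> 0)"
      using black_hole bh_om_horizon bh_om_nonzero by blast
  qed
qed

end
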